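(* Let $R$ be a standard graded ring of finite $F$-representation type over an $F$-finite field $R_0$ of prime characteristic $p>0$, with irrelevant ideal $\mathfrak m$, and let $I\subseteq R$ be a homogeneous ideal. Then there is $b\in\mathbb N_0$, not depending on $q$, such that $\mathfrak m^{bq}H^0_{\mathfrak m}(R/I^{[q]})=0$ for all $q=p^n$, $n\in\mathbb N$.
   Context: $\mathbb N=\{1,2,\dots\}$, $\mathbb N_0=\mathbb N\cup\{0\}$. $I^{[q]}=(x^q:x\in I)$; $H^0_{\mathfrak m}(M)$ is the submodule of elements of $M$ annihilated by some power of $\mathfrak m$. Let $F^n(R)$ denote the ring $R$ viewed as an $R$-module via the $n$-th Frobenius map ($b$ acts on $r$ as $b^{p^n}r$), with the $\mathbb Q$-grading in which an element $r$ homogeneous of degree $e$ in $R$ has degree $e/p^n$. $R$ has finite $F$-representation type if there are finitely generated $\mathbb Q$-graded $R$-modules $M_1,\dots,M_s$ such that for every $q=p^n$ there exist nonnegative integers $m_{qi}$ and rational numbers $\ell^{(q)}_{i,j}$ with $F^n(R)\cong\bigoplus_{i=1}^s\bigoplus_{j=1}^{m_{qi}}M_i(\ell^{(q)}_{i,j})$ as $\mathbb Q$-graded $R$-modules. *)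

theory Defs
  imports "HOL-Algebra.Algebra" "HOL-Computational_Algebra.Primes"
begin

section \<open>Gradings\<close>

text \<open>\<open>M\<close> is the internal direct sum of the additive subgroups \<open>D i\<close>; the index type may be
  infinite, so the families of components are required to have finite support.\<close>

definition direct_decomposition :: "('a, 'b) ring_scheme \<Rightarrow> ('i \<Rightarrow> 'a set) \<Rightarrow> bool" where
  "direct_decomposition M D \<longleftrightarrow>
     (\<forall>i. additive_subgroup (D i) M) \<and>
     (\<forall>x\<in>carrier M. \<exists>!f. (\<forall>i. f i \<in> D i) \<and> finite {i. f i \<noteq> \<zero>\<^bsub>M\<^esub>} \<and>
        x = (\<Oplus>\<^bsub>M\<^esub>i\<in>{i. f i \<noteq> \<zero>\<^bsub>M\<^esub>}. f i))"

text \<open>A standard graded ring: \<open>R = R\<^sub>0[x\<^sub>1, \<dots>, x\<^sub>k]\<close> with finitely many \<open>x\<^sub>i\<close> of degree one.\<close>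

definition standard_graded_ring :: "('a, 'b) ring_scheme \<Rightarrow> (nat \<Rightarrow> 'a set) \<Rightarrow> bool" where
  "standard_graded_ring R A \<longleftrightarrow>
     cring R \<and> direct_decomposition R A \<and>
     (\<forall>i j. \<forall>a\<in>A i. \<forall>b\<in>A j. a \<otimes>\<^bsub>R\<^esub> b \<in> A (i + j)) \<and>
     (\<exists>G. finite G \<and> G \<subseteq> A 1 \<and> generate_ring R (A 0 \<union> G) = carrier R)"

definition irrelevant_ideal :: "('a, 'b) ring_scheme \<Rightarrow> (nat \<Rightarrow> 'a set) \<Rightarrow> 'a set" where
  "irrelevant_ideal R A =
     {(\<Oplus>\<^bsub>R\<^esub>n\<in>N. f n) | f N. finite N \<and> N \<subseteq> {1..} \<and> (\<forall>n\<in>N. f n \<in> A n)}"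

definition homogeneous_ideal :: "('a, 'b) ring_scheme \<Rightarrow> (nat \<Rightarrow> 'a set) \<Rightarrow> 'a set \<Rightarrow> bool" where
  "homogeneous_ideal R A I \<longleftrightarrow> (\<exists>S. S \<subseteq> (\<Union>n. A n) \<and> I = Idl\<^bsub>R\<^esub> S)"

definition rat_graded_module ::
  "('a, 'b) ring_scheme \<Rightarrow> (nat \<Rightarrow> 'a set) \<Rightarrow> ('a, 'm) module \<Rightarrow> (rat \<Rightarrow> 'm set) \<Rightarrow> bool" where
  "rat_graded_module R A M D \<longleftrightarrow>
     module R M \<and> direct_decomposition M D \<and>
     (\<forall>n t. \<forall>a\<in>A n. \<forall>x\<in>D t. a \<odot>\<^bsub>M\<^esub> x \<in> D (of_nat n + t))"

definition shifted :: "(rat \<Rightarrow> 'm set) \<Rightarrow> rat \<Rightarrow> rat \<Rightarrow> 'm set" where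
  "shifted D l = (\<lambda>t. D (l + t))"

section \<open>Modules\<close>

definition fin_gen_module :: "('a, 'b) ring_scheme \<Rightarrow> ('a, 'm) module \<Rightarrow> bool" where
  "fin_gen_module R M \<longleftrightarrow>
     (\<exists>B. finite B \<and> B \<subseteq> carrier M \<and>
        (\<forall>x\<in>carrier M. \<exists>c \<in> B \<rightarrow> carrier R. x = (\<Oplus>\<^bsub>M\<^esub>b\<in>B. c b \<odot>\<^bsub>M\<^esub> b)))"

text \<open>The direct sum over a finite index set \<open>J\<close>. The fields \<open>mult\<close> and \<open>one\<close> of a module record
  carry no meaning for modules.\<close>

definition finite_direct_sum :: "'i set \<Rightarrow> ('i \<Rightarrow> ('a, 'm) module) \<Rightarrow> ('a, 'i \<Rightarrow> 'm) module" where
  "finite_direct_sum J M =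
     \<lparr>carrier = (\<Pi>\<^sub>E i\<in>J. carrier (M i)),
      monoid.mult = (\<lambda>x y. \<lambda>i\<in>J. x i \<otimes>\<^bsub>M i\<^esub> y i), one = (\<lambda>i\<in>J. \<one>\<^bsub>M i\<^esub>),
      ring.zero = (\<lambda>i\<in>J. \<zero>\<^bsub>M i\<^esub>), add = (\<lambda>x y. \<lambda>i\<in>J. x i \<oplus>\<^bsub>M i\<^esub> y i),
      smult = (\<lambda>a x. \<lambda>i\<in>J. a \<odot>\<^bsub>M i\<^esub> x i)\<rparr>"

definition direct_sum_grading :: "'i set \<Rightarrow> ('i \<Rightarrow> rat \<Rightarrow> 'm set) \<Rightarrow> rat \<Rightarrow> ('i \<Rightarrow> 'm) set" where
  "direct_sum_grading J D = (\<lambda>t. \<Pi>\<^sub>E i\<in>J. D i t)"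

definition graded_isomorphic ::
  "('a, 'b) ring_scheme \<Rightarrow> ('a, 'm) module \<Rightarrow> (rat \<Rightarrow> 'm set) \<Rightarrow>
     ('a, 'n) module \<Rightarrow> (rat \<Rightarrow> 'n set) \<Rightarrow> bool" where
  "graded_isomorphic R M D N E \<longleftrightarrow>
     (\<exists>h \<in> iso (add_monoid M) (add_monoid N).
        (\<forall>a\<in>carrier R. \<forall>x\<in>carrier M. h (a \<odot>\<^bsub>M\<^esub> x) = a \<odot>\<^bsub>N\<^esub> h x) \<and>
        (\<forall>t. h ` D t = E t))"

definition quotient_module :: "('a, 'b) ring_scheme \<Rightarrow> 'a set \<Rightarrow> ('a, 'a set) module" where
  "quotient_module R J =
     ring.extend (R Quot J) (module.fields (\<lambda>a C. (J +>\<^bsub>R\<^esub> a) \<otimes>\<^bsub>R Quot J\<^esub> C))"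

text \<open>Powers of ideals are powers in the monoid \<open>ideals_set R\<close> of ideals under multiplication,
  so that the zeroth power is \<open>R\<close>.\<close>

definition zeroth_local_cohomology ::
  "('a, 'b) ring_scheme \<Rightarrow> 'a set \<Rightarrow> ('a, 'm) module \<Rightarrow> 'm set" where
  "zeroth_local_cohomology R J M =
     {x \<in> carrier M. \<exists>k::nat. \<forall>a \<in> J [^]\<^bsub>ideals_set R\<^esub> k. a \<odot>\<^bsub>M\<^esub> x = \<zero>\<^bsub>M\<^esub>}"

definition ideal_smult :: "('a, 'm) module \<Rightarrow> 'a set \<Rightarrow> 'm set \<Rightarrow> 'm set" where
  "ideal_smult M J N = generate (add_monoid M) {a \<odot>\<^bsub>M\<^esub> x | a x. a \<in> J \<and> x \<in> N}"

section \<open>Frobenius\<close>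

definition frobenius_power :: "('a, 'b) ring_scheme \<Rightarrow> 'a set \<Rightarrow> nat \<Rightarrow> 'a set" where
  "frobenius_power R I q = Idl\<^bsub>R\<^esub> {x [^]\<^bsub>R\<^esub> q | x. x \<in> I}"

text \<open>A subfield \<open>K\<close> of characteristic \<open>p\<close> is F-finite if it has finite degree over its
  subfield of \<open>p\<close>-th powers.\<close>

definition F_finite :: "('a, 'b) ring_scheme \<Rightarrow> nat \<Rightarrow> 'a set \<Rightarrow> bool" where
  "F_finite R p K \<longleftrightarrow> ring.finite_dimension R ((\<lambda>x. x [^]\<^bsub>R\<^esub> p) ` K) K"

definition frobenius_module :: "('a, 'b) ring_scheme \<Rightarrow> nat \<Rightarrow> nat \<Rightarrow> ('a, 'a) module" where
  "frobenius_module R p n =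
     \<lparr>carrier = carrier R, monoid.mult = monoid.mult R, one = \<one>\<^bsub>R\<^esub>, ring.zero = \<zero>\<^bsub>R\<^esub>, add = add R,
      smult = (\<lambda>b r. b [^]\<^bsub>R\<^esub> (p ^ n) \<otimes>\<^bsub>R\<^esub> r)\<rparr>"

text \<open>At most one degree \<open>e\<close> contributes to the union; \<open>\<zero>\<close> is added since the component is the
  zero group if \<open>t\<close> is not of the form \<open>e / p ^ n\<close>.\<close>

definition frobenius_grading ::
  "('a, 'b) ring_scheme \<Rightarrow> (nat \<Rightarrow> 'a set) \<Rightarrow> nat \<Rightarrow> nat \<Rightarrow> rat \<Rightarrow> 'a set" where
  "frobenius_grading R A p n =
     (\<lambda>t. {\<zero>\<^bsub>R\<^esub>} \<union> (\<Union>e\<in>{e. of_nat e / of_nat (p ^ n) = t}. A e))"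

text \<open>HOL cannot quantify existentially over the carrier types of the modules \<open>M i\<close>, so a type
  \<open>'m\<close> containing these carriers is an argument. In a theorem assuming finite F-representation
  type, \<open>'m\<close> is a free type variable, so the theorem applies to modules on any type.\<close>

definition finite_F_representation_type ::
  "'m itself \<Rightarrow> ('a, 'b) ring_scheme \<Rightarrow> (nat \<Rightarrow> 'a set) \<Rightarrow> nat \<Rightarrow> bool" where
  "finite_F_representation_type (_ :: 'm itself) R A p \<longleftrightarrow>
     (\<exists>(s::nat) (M :: nat \<Rightarrow> ('a, 'm) module) (D :: nat \<Rightarrow> rat \<Rightarrow> 'm set).
        (\<forall>i<s. rat_graded_module R A (M i) (D i) \<and> fin_gen_module R (M i)) \<and>
        (\<forall>n\<ge>1. \<exists>(m :: nat \<Rightarrow> nat) (l :: nat \<Rightarrow> nat \<Rightarrow> rat).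
           let J = (SIGMA i:{..<s}. {..<m i}) in
           graded_isomorphic R
             (frobenius_module R p n) (frobenius_grading R A p n)
             (finite_direct_sum J (\<lambda>(i, j). M i))
             (direct_sum_grading J (\<lambda>(i, j). shifted (D i) (l i j)))))"

end

(* Viewing R as F^n(R), the ideal I^[q] becomes I F^n(R), so r is in I^[q] iff all components of r
   under F^n(R) = sum of the M_i lie in I M_i. Each M_i is Noetherian, hence the chain of the
   submodules {v. m^k v <= I M_i} stabilises, say at k = c for all of the finitely many i. So if some
   power of m multiplies r into I^[q], then so do the q-th powers of the elements of m^c. If m is
   generated by g elements of degree one, then m^((c+g)q) lies in the ideal generated by these q-th
   powers, by the pigeonhole principle for monomials; thus b = c + g. *)
theory Submission
  imports Defs
begin

section \<open>Noetherian modules\<close>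

text \<open>Uniformity in q comes from the fact that the modules \<open>M i\<close> do not change
  with n; only the number of copies and the shifts do. A bound extracted from the finitely many
  \<open>M i\<close> and their submodules I M_i therefore serves every q at once. The price is the
  twisted action: a acts on F^n(R) as a^q, so such a bound controls only the elements a^q with a in
  m^c. The ideal they generate is contained in m^(cq), in general properly. The summand g pays for
  the difference: dividing the g exponents of a monomial by q leaves g remainders, each below q.
  That the M_i are Noetherian has to be derived. R is generated as a ring by a field and a finite
  set \<open>G\<close>, and Hilbert's basis theorem is run on modules: start from a
  finite-dimensional space over the field that contains module generators, and adjoin the elements
  of \<open>G\<close> one at a time as operators. The irrelevant ideal is given by sums of
  homogeneous elements, whereas the count of exponents speaks of monomials in \<open>G\<close>;
  identifying it with \<open>Idl G\<close> is a separate argument about the grading.\<close>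

context abelian_group begin

lemma additive_subgroup_closureI:
  assumes "H \<subseteq> carrier G" "\<zero> \<in> H" "\<And>x y. x \<in> H \<Longrightarrow> y \<in> H \<Longrightarrow> x \<oplus> y \<in> H"
    "\<And>x. x \<in> H \<Longrightarrow> \<ominus> x \<in> H"
  shows "additive_subgroup H G"
  using assms by (auto simp: additive_subgroup_def a_inv_def intro!: add.subgroupI)

lemma additive_subgroup_minus_closed:
  assumes "additive_subgroup H G" "x \<in> H"
  shows "\<ominus> x \<in> H"
  using assms additive_subgroup.a_subgroup subgroup.m_inv_closed a_inv_def by metis

lemma additive_subgroup_finsum_closed:
  assumes "additive_subgroup H G" "\<And>i. i \<in> N \<Longrightarrow> f i \<in> H"
  shows "finsum G f N \<in> H"
  using assms(2)
proof (induction N rule: infinite_finite_induct)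
  case (insert i N)
  have "H \<subseteq> carrier G" using assms(1) by (rule additive_subgroup.a_subset)
  with insert show ?case
    by (subst finsum_insert) (auto intro: additive_subgroup.a_closed[OF assms(1)])
qed (auto simp: finsum_infinite finsum_empty additive_subgroup.zero_closed[OF assms(1)])

end

text \<open>\<open>S\<close> is a mere set of operators. Thus the ring can be adjoined one generator at a time, and the
  subrings generated on the way are never needed.\<close>

definition op_subgroup :: "('a, 'm, 'c) module_scheme \<Rightarrow> 'a set \<Rightarrow> 'm set \<Rightarrow> bool" where
  "op_subgroup M S N \<longleftrightarrow> additive_subgroup N M \<and> (\<forall>s\<in>S. \<forall>x\<in>N. s \<odot>\<^bsub>M\<^esub> x \<in> N)"

text \<open>With \<open>S = carrier R\<close> and \<open>N = carrier M\<close> this is the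
  Noetherian property. Both parameters vary in the proof: \<open>N\<close> grows while operators are
  added to \<open>S\<close>.\<close>

definition acc_submodules :: "('a, 'm, 'c) module_scheme \<Rightarrow> 'a set \<Rightarrow> 'm set \<Rightarrow> bool" where
  "acc_submodules M S N \<longleftrightarrow> (\<forall>J :: nat \<Rightarrow> 'm set.
     (\<forall>n. op_subgroup M S (J n) \<and> J n \<subseteq> N \<and> J n \<subseteq> J (Suc n)) \<longrightarrow>
     (\<exists>k. \<forall>n\<ge>k. J n = J k))"

lemma acc_submodulesD:
  assumes "acc_submodules M S N" "\<And>n. op_subgroup M S (J n)" "\<And>n. J n \<subseteq> N" "\<And>n. J n \<subseteq> J (Suc n)"
  shows "\<exists>k. \<forall>n\<ge>k. J n = J k"
  using assms unfolding acc_submodules_def by blast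

context module begin

lemma op_subgroupI:
  assumes "N \<subseteq> carrier M" "\<zero>\<^bsub>M\<^esub> \<in> N" "\<And>x y. x \<in> N \<Longrightarrow> y \<in> N \<Longrightarrow> x \<oplus>\<^bsub>M\<^esub> y \<in> N"
    "\<And>x. x \<in> N \<Longrightarrow> \<ominus>\<^bsub>M\<^esub> x \<in> N" "\<And>s x. s \<in> S \<Longrightarrow> x \<in> N \<Longrightarrow> s \<odot>\<^bsub>M\<^esub> x \<in> N"
  shows "op_subgroup M S N"
  using assms by (auto simp: op_subgroup_def intro!: M.additive_subgroup_closureI)

lemma op_subgroupD:
  assumes "op_subgroup M S N"
  shows "x \<in> N \<Longrightarrow> x \<in> carrier M" "\<zero>\<^bsub>M\<^esub> \<in> N" "x \<in> N \<Longrightarrow> y \<in> N \<Longrightarrow> x \<oplus>\<^bsub>M\<^esub> y \<in> N"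
    "x \<in> N \<Longrightarrow> \<ominus>\<^bsub>M\<^esub> x \<in> N" "s \<in> S \<Longrightarrow> x \<in> N \<Longrightarrow> s \<odot>\<^bsub>M\<^esub> x \<in> N"
  using assms additive_subgroup.a_subset[of N M] additive_subgroup.zero_closed[of N M]
    additive_subgroup.a_closed[of N M] M.additive_subgroup_minus_closed[of N]
  unfolding op_subgroup_def by blast+

lemma smult_left_commute:
  assumes "a \<in> carrier R" "b \<in> carrier R" "x \<in> carrier M"
  shows "a \<odot>\<^bsub>M\<^esub> (b \<odot>\<^bsub>M\<^esub> x) = b \<odot>\<^bsub>M\<^esub> (a \<odot>\<^bsub>M\<^esub> x)"
  using assms by (simp add: smult_assoc1[symmetric] R.m_comm)

text \<open>Cancels a common leading term: two elements of a chain with the same leading term differ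
  by something of lower degree.\<close>

lemma add_diff_cancel_left:
  assumes "x \<in> carrier M" "y \<in> carrier M" "z \<in> carrier M"
  shows "(x \<oplus>\<^bsub>M\<^esub> y) \<oplus>\<^bsub>M\<^esub> \<ominus>\<^bsub>M\<^esub> (x \<oplus>\<^bsub>M\<^esub> z) = y \<oplus>\<^bsub>M\<^esub> \<ominus>\<^bsub>M\<^esub> z"
proof -
  have "(x \<oplus>\<^bsub>M\<^esub> y) \<oplus>\<^bsub>M\<^esub> \<ominus>\<^bsub>M\<^esub> (x \<oplus>\<^bsub>M\<^esub> z) = (x \<oplus>\<^bsub>M\<^esub> \<ominus>\<^bsub>M\<^esub> x) \<oplus>\<^bsub>M\<^esub> (y \<oplus>\<^bsub>M\<^esub> \<ominus>\<^bsub>M\<^esub> z)"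
    using assms by (simp add: M.minus_add M.a_ac)
  then show ?thesis using assms by (simp add: M.r_neg)
qed

lemma op_subgroup_sum:
  assumes "op_subgroup M S N" "op_subgroup M S N'" "S \<subseteq> carrier R"
  shows "op_subgroup M S {u \<oplus>\<^bsub>M\<^esub> v | u v. u \<in> N \<and> v \<in> N'}" (is "op_subgroup M S ?T")
proof (rule op_subgroupI)
  note N = op_subgroupD[OF assms(1)] and N' = op_subgroupD[OF assms(2)]
  show "?T \<subseteq> carrier M" using N(1) N'(1) by auto
  show "\<zero>\<^bsub>M\<^esub> \<in> ?T" using N(2) N'(2) by (auto intro!: exI[of _ "\<zero>\<^bsub>M\<^esub>"])
  fix x assume "x \<in> ?T"
  then obtain u v where x: "u \<in> N" "v \<in> N'" "x = u \<oplus>\<^bsub>M\<^esub> v" by auto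
  have "\<ominus>\<^bsub>M\<^esub> x = \<ominus>\<^bsub>M\<^esub> u \<oplus>\<^bsub>M\<^esub> \<ominus>\<^bsub>M\<^esub> v" using x N(1) N'(1) by (simp add: M.minus_add)
  then show "\<ominus>\<^bsub>M\<^esub> x \<in> ?T" using x N(4) N'(4) by blast
  {
    fix s assume s: "s \<in> S"
    have "s \<odot>\<^bsub>M\<^esub> x = s \<odot>\<^bsub>M\<^esub> u \<oplus>\<^bsub>M\<^esub> s \<odot>\<^bsub>M\<^esub> v"
      using x N(1) N'(1) s assms(3) by (auto simp: smult_r_distr)
    then show "s \<odot>\<^bsub>M\<^esub> x \<in> ?T" using x N(5) N'(5) s by blast
  }
  fix y assume "y \<in> ?T"
  then obtain u' v' where y: "u' \<in> N" "v' \<in> N'" "y = u' \<oplus>\<^bsub>M\<^esub> v'" by auto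
  have "x \<oplus>\<^bsub>M\<^esub> y = (u \<oplus>\<^bsub>M\<^esub> u') \<oplus>\<^bsub>M\<^esub> (v \<oplus>\<^bsub>M\<^esub> v')" using x y N(1) N'(1) by (simp add: M.a_ac)
  then show "x \<oplus>\<^bsub>M\<^esub> y \<in> ?T" using x y N(3) N'(3) by blast
qed

text \<open>For \<open>a = x\<^sup>d\<close> and \<open>P\<close> the polynomials of degree below \<open>d\<close>, these are the leading coefficients of
  the elements of \<open>J\<close>; for \<open>a = \<one>\<close> it is the image of \<open>J\<close> modulo \<open>P\<close>.\<close>

lemma op_subgroup_coeff:
  assumes "op_subgroup M S N" "op_subgroup M S P" "op_subgroup M S J" "S \<subseteq> carrier R" "a \<in> carrier R"
  shows "op_subgroup M S {u \<in> N. \<exists>f\<in>P. a \<odot>\<^bsub>M\<^esub> u \<oplus>\<^bsub>M\<^esub> f \<in> J}" (is "op_subgroup M S ?T")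
proof (rule op_subgroupI)
  note N = op_subgroupD[OF assms(1)] and P = op_subgroupD[OF assms(2)]
    and J = op_subgroupD[OF assms(3)]
  show "?T \<subseteq> carrier M" using N(1) by auto
  show "\<zero>\<^bsub>M\<^esub> \<in> ?T" using N(2) P(2) J(2) assms(5) by (auto intro!: bexI[of _ "\<zero>\<^bsub>M\<^esub>"])
  fix u assume "u \<in> ?T"
  then obtain f where x: "u \<in> N" "f \<in> P" "a \<odot>\<^bsub>M\<^esub> u \<oplus>\<^bsub>M\<^esub> f \<in> J" by auto
  have "a \<odot>\<^bsub>M\<^esub> (\<ominus>\<^bsub>M\<^esub> u) \<oplus>\<^bsub>M\<^esub> \<ominus>\<^bsub>M\<^esub> f = \<ominus>\<^bsub>M\<^esub> (a \<odot>\<^bsub>M\<^esub> u \<oplus>\<^bsub>M\<^esub> f)"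
    using x N(1) P(1) assms(5) by (simp add: M.minus_add smult_r_minus)
  then show "\<ominus>\<^bsub>M\<^esub> u \<in> ?T" using x N(4) P(4) J(4) by force
  {
    fix s assume s: "s \<in> S"
    have "a \<odot>\<^bsub>M\<^esub> (s \<odot>\<^bsub>M\<^esub> u) = s \<odot>\<^bsub>M\<^esub> (a \<odot>\<^bsub>M\<^esub> u)"
      using x N(1) s assms(4,5) by (intro smult_left_commute) auto
    then have "a \<odot>\<^bsub>M\<^esub> (s \<odot>\<^bsub>M\<^esub> u) \<oplus>\<^bsub>M\<^esub> s \<odot>\<^bsub>M\<^esub> f = s \<odot>\<^bsub>M\<^esub> (a \<odot>\<^bsub>M\<^esub> u \<oplus>\<^bsub>M\<^esub> f)"
      using x N(1) P(1) s assms(4,5) by (auto simp: smult_r_distr)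
    then show "s \<odot>\<^bsub>M\<^esub> u \<in> ?T" using x N(5) P(5) J(5) s by force
  }
  fix v assume "v \<in> ?T"
  then obtain g where y: "v \<in> N" "g \<in> P" "a \<odot>\<^bsub>M\<^esub> v \<oplus>\<^bsub>M\<^esub> g \<in> J" by auto
  have "a \<odot>\<^bsub>M\<^esub> (u \<oplus>\<^bsub>M\<^esub> v) \<oplus>\<^bsub>M\<^esub> (f \<oplus>\<^bsub>M\<^esub> g) = (a \<odot>\<^bsub>M\<^esub> u \<oplus>\<^bsub>M\<^esub> f) \<oplus>\<^bsub>M\<^esub> (a \<odot>\<^bsub>M\<^esub> v \<oplus>\<^bsub>M\<^esub> g)"
    using x y N(1) P(1) assms(5) by (simp add: smult_r_distr M.a_ac)
  then show "u \<oplus>\<^bsub>M\<^esub> v \<in> ?T" using x y N(3) P(3) J(3) by force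
qed

text \<open>A chain is controlled by its intersections with \<open>N'\<close> and its images modulo
  \<open>N'\<close>, as for extensions of Noetherian modules. The sum need not be direct, so the
  image is taken as the set \<open>?B\<close> of all possible \<open>N\<close>-parts.\<close>

lemma acc_submodules_sum:
  assumes N: "op_subgroup M S N" "acc_submodules M S N" and N': "op_subgroup M S N'" "acc_submodules M S N'"
    and S: "S \<subseteq> carrier R"
  shows "acc_submodules M S {u \<oplus>\<^bsub>M\<^esub> v | u v. u \<in> N \<and> v \<in> N'}"
  unfolding acc_submodules_def
proof (intro allI impI)
  fix J :: "nat \<Rightarrow> _"
  assume "\<forall>n. op_subgroup M S (J n) \<and> J n \<subseteq> {u \<oplus>\<^bsub>M\<^esub> v | u v. u \<in> N \<and> v \<in> N'} \<and> J n \<subseteq> J (Suc n)"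
  then have J: "\<forall>n. op_subgroup M S (J n)" "\<forall>n. J n \<subseteq> {u \<oplus>\<^bsub>M\<^esub> v | u v. u \<in> N \<and> v \<in> N'}"
    and J_Suc: "\<And>n. J n \<subseteq> J (Suc n)" by blast+
  then have mono: "J m \<subseteq> J n" if "m \<le> n" for m n using lift_Suc_mono_le[of J] that by blast
  note J' = op_subgroupD[OF J(1)[rule_format]] and N'' = op_subgroupD[OF N(1)]
    and N''' = op_subgroupD[OF N'(1)]
  let ?B = "\<lambda>n. {u \<in> N. \<exists>f\<in>N'. \<one> \<odot>\<^bsub>M\<^esub> u \<oplus>\<^bsub>M\<^esub> f \<in> J n}"
  have "op_subgroup M S (J n \<inter> N')" for n
    by (rule op_subgroupI) (use J' N''' in auto)
  then have "\<exists>k. \<forall>n\<ge>k. J n \<inter> N' = J k \<inter> N'"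
    by (rule acc_submodulesD[OF N'(2)]) (use J_Suc in auto)
  then obtain k where k: "\<And>n. k \<le> n \<Longrightarrow> J n \<inter> N' = J k \<inter> N'" by blast
  have "op_subgroup M S (?B n)" for n
    by (rule op_subgroup_coeff) (use N N' J S in auto)
  then have "\<exists>l. \<forall>n\<ge>l. ?B n = ?B l"
    by (rule acc_submodulesD[OF N(2)]) (use J_Suc in auto)
  then obtain l where l: "\<And>n. l \<le> n \<Longrightarrow> ?B n = ?B l" by blast
  show "\<exists>k. \<forall>n\<ge>k. J n = J k"
  proof (intro exI allI impI)
    fix n assume n: "max k l \<le> n"
    show "J n = J (max k l)"
    proof
      show "J (max k l) \<subseteq> J n" using mono n by blast
      show "J n \<subseteq> J (max k l)"
      proof
        fix z assume z: "z \<in> J n"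
        then obtain u v where uv: "u \<in> N" "v \<in> N'" "z = u \<oplus>\<^bsub>M\<^esub> v" using J(2) by blast
        then have "u \<in> ?B n" using z N'' by auto
        then have "u \<in> ?B (max k l)" using l[of n] l[of "max k l"] n by simp
        then obtain v' where v': "v' \<in> N'" "u \<oplus>\<^bsub>M\<^esub> v' \<in> J (max k l)" using N''(1) uv by auto
        \<comment> \<open>\<open>z\<close> and \<open>u \<oplus> v'\<close> have the same
          \<open>N\<close>-part, so their difference lies in \<open>J n\<close> and in
          \<open>N'\<close>, where the chain has already become stationary.\<close>
        let ?d = "v \<oplus>\<^bsub>M\<^esub> \<ominus>\<^bsub>M\<^esub> v'"
        have d: "?d = z \<oplus>\<^bsub>M\<^esub> \<ominus>\<^bsub>M\<^esub> (u \<oplus>\<^bsub>M\<^esub> v')"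
          using add_diff_cancel_left uv v' N'' N''' by simp
        have "?d \<in> J n" unfolding d using J'(3)[OF z J'(4)] mono[OF n] v' by blast
        then have "?d \<in> J (max k l)" using k[of n] k[of "max k l"] n uv v' N''' by auto
        then have "?d \<oplus>\<^bsub>M\<^esub> (u \<oplus>\<^bsub>M\<^esub> v') \<in> J (max k l)" using J'(3) v' by blast
        moreover have "?d \<oplus>\<^bsub>M\<^esub> (u \<oplus>\<^bsub>M\<^esub> v') = z"
          unfolding d using z v' J'(1) by (simp add: M.a_assoc M.l_neg)
        ultimately show "z \<in> J (max k l)" by simp
      qed
    qed
  qed
qed

text \<open>The \<open>x\<close>-polynomials of degree less than \<open>d\<close> with coefficients in \<open>N\<close>.\<close>

primrec poly_filt :: "'a \<Rightarrow> 'c set \<Rightarrow> nat \<Rightarrow> 'c set" where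
  "poly_filt x N 0 = {\<zero>\<^bsub>M\<^esub>}"
| "poly_filt x N (Suc d) = {(x [^] d) \<odot>\<^bsub>M\<^esub> u \<oplus>\<^bsub>M\<^esub> f | u f. u \<in> N \<and> f \<in> poly_filt x N d}"

lemma op_subgroup_poly_filt:
  assumes N: "op_subgroup M S N" and x: "x \<in> carrier R" and S: "S \<subseteq> carrier R"
  shows "op_subgroup M S (poly_filt x N d)"
proof (induction d)
  case 0
  show ?case by (rule op_subgroupI) (use S in auto)
next
  case (Suc d)
  let ?N = "(\<odot>\<^bsub>M\<^esub>) (x [^] d) ` N"
  note N' = op_subgroupD[OF N]
  have "op_subgroup M S ?N"
  proof (rule op_subgroupI)
    show "\<zero>\<^bsub>M\<^esub> \<in> ?N" using N'(2) x by (auto intro!: image_eqI[of _ _ "\<zero>\<^bsub>M\<^esub>"])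
    show "?N \<subseteq> carrier M" using N' x by auto
  next
    fix y z assume "y \<in> ?N" "z \<in> ?N"
    then obtain u v where "u \<in> N" "v \<in> N" "y = (x [^] d) \<odot>\<^bsub>M\<^esub> u" "z = (x [^] d) \<odot>\<^bsub>M\<^esub> v" by auto
    then show "y \<oplus>\<^bsub>M\<^esub> z \<in> ?N" using N' x by (auto simp: smult_r_distr[symmetric])
  next
    fix y assume "y \<in> ?N"
    then obtain u where "u \<in> N" "y = (x [^] d) \<odot>\<^bsub>M\<^esub> u" by auto
    then show "\<ominus>\<^bsub>M\<^esub> y \<in> ?N" using N' x by (auto simp: smult_r_minus[symmetric])
  next
    fix s y assume s: "s \<in> S" and "y \<in> ?N"
    then obtain u where u: "u \<in> N" "y = (x [^] d) \<odot>\<^bsub>M\<^esub> u" by auto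
    then have "s \<odot>\<^bsub>M\<^esub> y = (x [^] d) \<odot>\<^bsub>M\<^esub> (s \<odot>\<^bsub>M\<^esub> u)"
      using N'(1) x s S by (auto intro!: smult_left_commute)
    then show "s \<odot>\<^bsub>M\<^esub> y \<in> ?N" using s u N' by auto
  qed
  from op_subgroup_sum[OF this Suc S] show ?case
    by (rule back_subst[of "op_subgroup M S"]) auto
qed

lemma poly_filt_mono:
  assumes N: "op_subgroup M S N" and x: "x \<in> carrier R" and S: "S \<subseteq> carrier R"
    and "d \<le> e"
  shows "poly_filt x N d \<subseteq> poly_filt x N e"
proof -
  have "poly_filt x N d \<subseteq> poly_filt x N (Suc d)" for d
  proof
    fix f assume f: "f \<in> poly_filt x N d"
    have "f = (x [^] d) \<odot>\<^bsub>M\<^esub> \<zero>\<^bsub>M\<^esub> \<oplus>\<^bsub>M\<^esub> f"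
      using op_subgroupD(1)[OF op_subgroup_poly_filt[OF N x S] f] x by simp
    then show "f \<in> poly_filt x N (Suc d)" using op_subgroupD(2)[OF N] f by auto
  qed
  then show ?thesis using lift_Suc_mono_le[of "poly_filt x N"] assms(4) by blast
qed

lemma smult_poly_filt:
  assumes N: "op_subgroup M S N" and x: "x \<in> carrier R" and S: "S \<subseteq> carrier R"
    and "f \<in> poly_filt x N d"
  shows "x \<odot>\<^bsub>M\<^esub> f \<in> poly_filt x N (Suc d)"
  using assms(4)
proof (induction d arbitrary: f)
  case 0
  then show ?case using op_subgroupD(2)[OF op_subgroup_poly_filt[OF N x S, of "Suc 0"]] x by auto
next
  case (Suc d)
  then obtain u g where f: "u \<in> N" "g \<in> poly_filt x N d" "f = (x [^] d) \<odot>\<^bsub>M\<^esub> u \<oplus>\<^bsub>M\<^esub> g" by auto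
  have c: "u \<in> carrier M" "g \<in> carrier M"
    using f op_subgroupD(1)[OF N] op_subgroupD(1)[OF op_subgroup_poly_filt[OF N x S]] by auto
  have "x \<odot>\<^bsub>M\<^esub> f = (x [^] Suc d) \<odot>\<^bsub>M\<^esub> u \<oplus>\<^bsub>M\<^esub> x \<odot>\<^bsub>M\<^esub> g"
    using f x c by (simp add: smult_r_distr smult_assoc1[symmetric] R.m_comm)
  then show ?case using Suc.IH[OF f(2)] f(1) by auto
qed

text \<open>Multiplication by \<open>x\<close> raises the degree bound by one, so no single
  \<open>poly_filt x N d\<close> need be closed under it; the union is.\<close>

lemma op_subgroup_adjoin:
  assumes N: "op_subgroup M S N" and x: "x \<in> carrier R" and S: "S \<subseteq> carrier R"
  shows "op_subgroup M (insert x S) (\<Union>d. poly_filt x N d)"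
proof (rule op_subgroupI)
  note F = op_subgroupD[OF op_subgroup_poly_filt[OF N x S]]
  show "(\<Union>d. poly_filt x N d) \<subseteq> carrier M" using F(1) by auto
  show "\<zero>\<^bsub>M\<^esub> \<in> (\<Union>d. poly_filt x N d)" using F(2) by auto
  fix y assume "y \<in> (\<Union>d. poly_filt x N d)"
  then obtain d where y: "y \<in> poly_filt x N d" by auto
  show "\<ominus>\<^bsub>M\<^esub> y \<in> (\<Union>d. poly_filt x N d)" using F(4) y by auto
  show "s \<odot>\<^bsub>M\<^esub> y \<in> (\<Union>d. poly_filt x N d)" if "s \<in> insert x S" for s
    using that F(5)[OF _ y] smult_poly_filt[OF N x S y] by blast
  fix z assume "z \<in> (\<Union>d. poly_filt x N d)"
  then obtain e where z: "z \<in> poly_filt x N e" by auto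
  have "y \<in> poly_filt x N (max d e)" "z \<in> poly_filt x N (max d e)"
    using y z poly_filt_mono[OF N x S] by (meson max.cobounded1 max.cobounded2 subsetD)+
  then show "y \<oplus>\<^bsub>M\<^esub> z \<in> (\<Union>d. poly_filt x N d)" using F(3) by blast
qed

lemma subset_adjoin:
  assumes "op_subgroup M S N"
  shows "N \<subseteq> (\<Union>d. poly_filt x N d)"
proof
  fix u assume "u \<in> N"
  then have "u \<in> poly_filt x N (Suc 0)" using op_subgroupD(1)[OF assms] by force
  then show "u \<in> (\<Union>d. poly_filt x N d)" by blast
qed

text \<open>The argument of Hilbert's basis theorem for chains: the modules \<open>L n d\<close> of leading coefficients in
  degree \<open>d\<close> increase in both \<open>n\<close> and \<open>d\<close>. The diagonal stabilises at some \<open>k\<close>, which settles all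
  \<open>d \<ge> k\<close>, and the finitely many \<open>d < k\<close> are settled one by one.\<close>

lemma acc_submodules_adjoin:
  assumes N: "op_subgroup M S N" "acc_submodules M S N" and x: "x \<in> carrier R" and S: "S \<subseteq> carrier R"
  shows "acc_submodules M (insert x S) (\<Union>d. poly_filt x N d)"
  unfolding acc_submodules_def
proof (intro allI impI)
  fix J :: "nat \<Rightarrow> _"
  assume "\<forall>n. op_subgroup M (insert x S) (J n) \<and> J n \<subseteq> (\<Union>d. poly_filt x N d) \<and> J n \<subseteq> J (Suc n)"
  then have J: "\<forall>n. op_subgroup M (insert x S) (J n)" "\<forall>n. J n \<subseteq> (\<Union>d. poly_filt x N d)"
    and J_Suc: "\<And>n. J n \<subseteq> J (Suc n)" by blast+
  then have mono: "J m \<subseteq> J n" if "m \<le> n" for m n using lift_Suc_mono_le[of J] that by blast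
  note J' = op_subgroupD[OF J(1)[rule_format]] and N' = op_subgroupD[OF N(1)]
    and F = op_subgroupD[OF op_subgroup_poly_filt[OF N(1) x S]]
  have JS: "op_subgroup M S (J n)" for n using J(1) by (auto simp: op_subgroup_def)
  define L where "L n d = {u \<in> N. \<exists>f\<in>poly_filt x N d. (x [^] d) \<odot>\<^bsub>M\<^esub> u \<oplus>\<^bsub>M\<^esub> f \<in> J n}" for n d
  have L: "op_subgroup M S (L n d)" for n d
    unfolding L_def by (rule op_subgroup_coeff) (use N x S JS op_subgroup_poly_filt in auto)
  have L_sub: "L n d \<subseteq> N" for n d unfolding L_def by auto
  have L_mono1: "L n d \<subseteq> L m d" if "n \<le> m" for n m d using mono[OF that] by (auto simp: L_def)
  \<comment> \<open>Multiplying by \<open>x\<close> keeps an element in \<open>J n\<close> and moves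
    its leading coefficient up one degree.\<close>
  have "L n d \<subseteq> L n (Suc d)" for n d
  proof
    fix u assume "u \<in> L n d"
    then obtain f where f: "u \<in> N" "f \<in> poly_filt x N d" "(x [^] d) \<odot>\<^bsub>M\<^esub> u \<oplus>\<^bsub>M\<^esub> f \<in> J n"
      unfolding L_def by auto
    have "x \<odot>\<^bsub>M\<^esub> ((x [^] d) \<odot>\<^bsub>M\<^esub> u \<oplus>\<^bsub>M\<^esub> f) = (x [^] Suc d) \<odot>\<^bsub>M\<^esub> u \<oplus>\<^bsub>M\<^esub> x \<odot>\<^bsub>M\<^esub> f"
      using f x N'(1) F(1) by (simp add: smult_r_distr smult_assoc1[symmetric] R.m_comm)
    then have "(x [^] Suc d) \<odot>\<^bsub>M\<^esub> u \<oplus>\<^bsub>M\<^esub> x \<odot>\<^bsub>M\<^esub> f \<in> J n" using J'(5) f(3) by (metis insertI1)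
    then show "u \<in> L n (Suc d)" unfolding L_def using f smult_poly_filt[OF N(1) x S] by blast
  qed
  then have L_mono2: "L n d \<subseteq> L n e" if "d \<le> e" for n d e
    using lift_Suc_mono_le[of "L n"] that by blast
  have "\<exists>k. \<forall>n\<ge>k. L n n = L k k"
  proof (rule acc_submodulesD[OF N(2)])
    show "L n n \<subseteq> L (Suc n) (Suc n)" for n
      using L_mono1[of n "Suc n" n] L_mono2[of n "Suc n" "Suc n"] by auto
  qed (use L L_sub in auto)
  then obtain k where k: "\<And>n. k \<le> n \<Longrightarrow> L n n = L k k" by blast
  have "\<exists>m. \<forall>n\<ge>m. L n d = L m d" for d
    by (rule acc_submodulesD[OF N(2)]) (use L L_sub L_mono1 in auto)
  then obtain c where c: "\<And>d n. c d \<le> n \<Longrightarrow> L n d = L (c d) d" by metis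
  \<comment> \<open>Beyond the diagonal index \<open>k\<close> and the finitely many indices
    \<open>c d\<close> with \<open>d < k\<close>, all leading coefficient modules are stable
    simultaneously.\<close>
  define m where "m = Max (insert k (c ` {..<k}))"
  have km: "k \<le> m" and cm: "\<And>d. d < k \<Longrightarrow> c d \<le> m" by (auto simp: m_def)
  have L_stable: "L n d \<subseteq> L m d" if "m \<le> n" for n d
  proof (cases "d < k")
    case True
    then show ?thesis using c[of d n] c[of d m] cm that by fastforce
  next
    case False
    \<comment> \<open>For \<open>d \<ge> k\<close> the module is caught between diagonal terms: it
      lies in one with a large index, which equals \<open>L k k\<close>, and \<open>L k k\<close>
      lies in \<open>L m d\<close>.\<close>
    have "L n d \<subseteq> L (max n d) (max n d)" using L_mono1 L_mono2 by (meson max.cobounded1 max.cobounded2 subset_trans)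
    also have "\<dots> = L k k" using k[of "max n d"] km that by simp
    also have "\<dots> \<subseteq> L m d" using L_mono1[OF km] L_mono2[of k d] False by (meson leI subset_trans)
    finally show ?thesis .
  qed
  \<comment> \<open>Induction on the degree: subtract from \<open>f\<close> an element of
    \<open>J m\<close> with the same leading coefficient. The remainder is still in
    \<open>J n\<close> and has lower degree.\<close>
  have step: "f \<in> J m" if "m \<le> n" "f \<in> J n" "f \<in> poly_filt x N d" for n d f
    using that(2,3)
  proof (induction d arbitrary: f)
    case 0
    then show ?case using J'(2) by auto
  next
    case (Suc d)
    then obtain u g where f: "u \<in> N" "g \<in> poly_filt x N d" "f = (x [^] d) \<odot>\<^bsub>M\<^esub> u \<oplus>\<^bsub>M\<^esub> g" by auto
    then have "u \<in> L n d" using Suc.prems unfolding L_def by auto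
    then have "u \<in> L m d" using L_stable that(1) by blast
    then obtain h where h: "h \<in> poly_filt x N d" "(x [^] d) \<odot>\<^bsub>M\<^esub> u \<oplus>\<^bsub>M\<^esub> h \<in> J m"
      unfolding L_def by auto
    let ?d = "g \<oplus>\<^bsub>M\<^esub> \<ominus>\<^bsub>M\<^esub> h" and ?h = "(x [^] d) \<odot>\<^bsub>M\<^esub> u \<oplus>\<^bsub>M\<^esub> h"
    have d: "?d = f \<oplus>\<^bsub>M\<^esub> \<ominus>\<^bsub>M\<^esub> ?h"
      unfolding f(3) by (rule add_diff_cancel_left[symmetric]) (use f h x N' F(1) in auto)
    have "?d \<in> J n" unfolding d using J'(3)[OF Suc.prems(1) J'(4)] mono[OF that(1)] h by blast
    moreover have "?d \<in> poly_filt x N d" using f h F(3,4) by blast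
    ultimately have "?d \<in> J m" by (rule Suc.IH)
    then have "?d \<oplus>\<^bsub>M\<^esub> ?h \<in> J m" using J'(3) h by blast
    moreover have "?d \<oplus>\<^bsub>M\<^esub> ?h = f"
      unfolding d using J'(1)[OF Suc.prems(1)] J'(1)[OF h(2)] by (simp add: M.a_assoc M.l_neg)
    ultimately show ?case by simp
  qed
  have "J n = J m" if "m \<le> n" for n
    using step[OF that] mono[OF that] J(2) by blast
  then show "\<exists>k. \<forall>n\<ge>k. J n = J k" by blast
qed

end

section \<open>Finitely generated modules over a ring generated by a field and finitely many
  elements\<close>

context module begin

lemma op_subgroup_cyclic:
  assumes "subring K R" "b \<in> carrier M"
  shows "op_subgroup M K ((\<lambda>c. c \<odot>\<^bsub>M\<^esub> b) ` K)"
proof (rule op_subgroupI)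
  note K = subringE[OF assms(1)]
  show "(\<lambda>c. c \<odot>\<^bsub>M\<^esub> b) ` K \<subseteq> carrier M" using K(1) assms(2) by auto
  show "\<zero>\<^bsub>M\<^esub> \<in> (\<lambda>c. c \<odot>\<^bsub>M\<^esub> b) ` K" using K(2) assms(2) by (auto intro!: image_eqI[of _ _ \<zero>])
  fix x assume "x \<in> (\<lambda>c. c \<odot>\<^bsub>M\<^esub> b) ` K"
  then obtain c where c: "c \<in> K" "x = c \<odot>\<^bsub>M\<^esub> b" by auto
  then have cR: "c \<in> carrier R" using K(1) by auto
  show "\<ominus>\<^bsub>M\<^esub> x \<in> (\<lambda>c. c \<odot>\<^bsub>M\<^esub> b) ` K"
    using c cR K(5) assms(2) by (auto intro!: image_eqI[of _ _ "\<ominus> c"] simp: smult_l_minus)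
  show "s \<odot>\<^bsub>M\<^esub> x \<in> (\<lambda>c. c \<odot>\<^bsub>M\<^esub> b) ` K" if "s \<in> K" for s
    using c cR K(1,6) assms(2) that by (auto intro!: image_eqI[of _ _ "s \<otimes> c"] simp: smult_assoc1)
  fix y assume "y \<in> (\<lambda>c. c \<odot>\<^bsub>M\<^esub> b) ` K"
  then obtain d where d: "d \<in> K" "y = d \<odot>\<^bsub>M\<^esub> b" by auto
  then have "d \<in> carrier R" using K(1) by auto
  then show "x \<oplus>\<^bsub>M\<^esub> y \<in> (\<lambda>c. c \<odot>\<^bsub>M\<^esub> b) ` K"
    using c d cR K(7) assms(2) by (auto intro!: image_eqI[of _ _ "c \<oplus> d"] simp: smult_l_distr)
qed

text \<open>A line over a field has no proper nonzero subspace: the coefficient of a nonzero element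
  is invertible in \<open>K\<close>, so \<open>b\<close> is recovered from it. Once a term of the
  chain is nonzero, it is the whole line.\<close>

lemma acc_submodules_cyclic:
  assumes K: "subfield K R" and b: "b \<in> carrier M"
  shows "acc_submodules M K ((\<lambda>c. c \<odot>\<^bsub>M\<^esub> b) ` K)"
  unfolding acc_submodules_def
proof (intro allI impI)
  fix J :: "nat \<Rightarrow> _"
  let ?N = "(\<lambda>c. c \<odot>\<^bsub>M\<^esub> b) ` K"
  assume asm: "\<forall>n. op_subgroup M K (J n) \<and> J n \<subseteq> ?N \<and> J n \<subseteq> J (Suc n)"
  then have mono: "J m \<subseteq> J n" if "m \<le> n" for m n using lift_Suc_mono_le[of J] that by blast
  have J: "op_subgroup M K (J n)" "J n \<subseteq> ?N" for n using asm by blast+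
  have KR: "K \<subseteq> carrier R" using subfieldE(3)[OF K] .
  show "\<exists>k. \<forall>n\<ge>k. J n = J k"
  proof (cases "\<forall>n. J n \<subseteq> {\<zero>\<^bsub>M\<^esub>}")
    case True
    then have "J n = {\<zero>\<^bsub>M\<^esub>}" for n using op_subgroupD(2)[OF J(1)] by blast
    then show ?thesis by simp
  next
    case False
    then obtain k x where x: "x \<in> J k" "x \<noteq> \<zero>\<^bsub>M\<^esub>" by blast
    then obtain c where c: "c \<in> K" "x = c \<odot>\<^bsub>M\<^esub> b" using J(2) by blast
    have "c \<noteq> \<zero>" using x c b by auto
    then have inv: "inv c \<in> K" "inv c \<otimes> c = \<one>" using subfield_m_inv[OF K] c by auto
    have "?N \<subseteq> J n" if "k \<le> n" for n
    proof
      fix y assume "y \<in> ?N"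
      then obtain d where d: "d \<in> K" "y = d \<odot>\<^bsub>M\<^esub> b" by auto
      have "inv c \<odot>\<^bsub>M\<^esub> x = b" using c inv KR b smult_assoc1[of "inv c" c b] by (auto simp: subset_iff)
      then have "y = d \<odot>\<^bsub>M\<^esub> (inv c \<odot>\<^bsub>M\<^esub> x)" using d by simp
      then show "y \<in> J n" using mono[OF that] x op_subgroupD(5)[OF J(1)] inv d by auto
    qed
    then have "J n = ?N" if "k \<le> n" for n using that J(2) by blast
    then show ?thesis by (metis order_refl)
  qed
qed

lemma acc_submodules_span:
  assumes K: "subfield K R" and "finite B" "B \<subseteq> carrier M"
  shows "\<exists>N. op_subgroup M K N \<and> acc_submodules M K N \<and> B \<subseteq> N"
  using assms(2,3)
proof (induction B)
  case empty
  have KR: "K \<subseteq> carrier R" using subfieldE(3)[OF K] .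
  have "op_subgroup M K {\<zero>\<^bsub>M\<^esub>}" by (rule op_subgroupI) (use KR in auto)
  moreover have "acc_submodules M K {\<zero>\<^bsub>M\<^esub>}"
    unfolding acc_submodules_def using op_subgroupD(2) by (metis subset_singletonD empty_iff)
  ultimately show ?case by blast
next
  case (insert b B)
  then obtain N where N: "op_subgroup M K N" "acc_submodules M K N" "B \<subseteq> N" by auto
  let ?C = "(\<lambda>c. c \<odot>\<^bsub>M\<^esub> b) ` K" and ?T = "{u \<oplus>\<^bsub>M\<^esub> v | u v. u \<in> N \<and> v \<in> (\<lambda>c. c \<odot>\<^bsub>M\<^esub> b) ` K}"
  have b: "b \<in> carrier M" using insert by auto
  have K': "subring K R" "K \<subseteq> carrier R" using subfieldE[OF K] by auto
  have C: "op_subgroup M K ?C" "acc_submodules M K ?C"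
    using op_subgroup_cyclic[OF K'(1) b] acc_submodules_cyclic[OF K b] by auto
  have "op_subgroup M K ?T" "acc_submodules M K ?T"
    using op_subgroup_sum[OF N(1) C(1) K'(2)] acc_submodules_sum[OF N(1,2) C K'(2)] by auto
  moreover have "insert b B \<subseteq> ?T"
  proof
    fix x assume "x \<in> insert b B"
    then consider "x = b" | "x \<in> B" by auto
    then show "x \<in> ?T"
    proof cases
      case 1
      have "b \<in> ?C" using b subringE(3)[OF K'(1)] by (auto intro!: image_eqI[of _ _ \<one>])
      moreover have "b = \<zero>\<^bsub>M\<^esub> \<oplus>\<^bsub>M\<^esub> b" using b by simp
      ultimately show ?thesis using 1 op_subgroupD(2)[OF N(1)] by blast
    next
      case 2
      then have "x \<in> N" "x \<in> carrier M" using N op_subgroupD(1) by auto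
      moreover from this have "x = x \<oplus>\<^bsub>M\<^esub> \<zero>\<^bsub>M\<^esub>" by simp
      ultimately show ?thesis using op_subgroupD(2)[OF C(1)] by blast
    qed
  qed
  ultimately show ?case by blast
qed

text \<open>Only \<open>B \<subseteq> N\<close> is recorded about \<open>N\<close>. If
  \<open>B\<close> generates \<open>M\<close> and the operators generate \<open>R\<close>, closure
  under the operators already forces \<open>N\<close> to be all of \<open>M\<close>.\<close>

lemma acc_submodules_adjoin_finite:
  assumes K: "subfield K R" and B: "finite B" "B \<subseteq> carrier M" and "finite G" "G \<subseteq> carrier R"
  shows "\<exists>N. op_subgroup M (G \<union> K) N \<and> acc_submodules M (G \<union> K) N \<and> B \<subseteq> N"
  using assms(4,5)
proof (induction G)
  case empty
  then show ?case using acc_submodules_span[OF K B] by simp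
next
  case (insert x G)
  then obtain N where N: "op_subgroup M (G \<union> K) N" "acc_submodules M (G \<union> K) N" "B \<subseteq> N" by auto
  have "x \<in> carrier R" "G \<union> K \<subseteq> carrier R" using insert subfieldE(3)[OF K] by auto
  then show ?case
    using op_subgroup_adjoin[OF N(1)] acc_submodules_adjoin[OF N(1,2)] subset_adjoin[OF N(1), of x] N(3)
    by (metis insert_is_Un sup_assoc subset_trans)
qed

lemma op_subgroup_generate_ring:
  assumes "op_subgroup M S N" "S \<subseteq> carrier R"
  shows "op_subgroup M (generate_ring R S) N"
proof -
  note N = op_subgroupD[OF assms(1)]
  have "\<forall>x\<in>N. r \<odot>\<^bsub>M\<^esub> x \<in> N" if "r \<in> generate_ring R S" for r
    using that
  proof induction
    case one
    then show ?case using N(1) by auto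
  next
    case (incl h)
    then show ?case using N(5) by auto
  next
    case (a_inv h)
    then show ?case using N(1,4) generate_ring_in_carrier[OF assms(2)] by (auto simp: smult_l_minus)
  next
    case (eng_add h1 h2)
    then show ?case using N(1,3) generate_ring_in_carrier[OF assms(2)] by (auto simp: smult_l_distr)
  next
    case (eng_mult h1 h2)
    then show ?case using N(1) generate_ring_in_carrier[OF assms(2)] by (auto simp: smult_assoc1)
  qed
  then show ?thesis using assms(1) by (auto simp: op_subgroup_def)
qed

end

lemma acc_submodules_fin_gen_module:
  fixes R :: "('a, 'b) ring_scheme" and M :: "('a, 'm) module"
  assumes "module R M" "fin_gen_module R M" "subfield K R" "finite G" "G \<subseteq> carrier R"
    "generate_ring R (K \<union> G) = carrier R"
  shows "acc_submodules M (carrier R) (carrier M)"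
proof -
  interpret module R M by fact
  obtain B where B: "finite B" "B \<subseteq> carrier M"
    "\<And>x. x \<in> carrier M \<Longrightarrow> \<exists>c \<in> B \<rightarrow> carrier R. x = (\<Oplus>\<^bsub>M\<^esub>b\<in>B. c b \<odot>\<^bsub>M\<^esub> b)"
    using assms(2) unfolding fin_gen_module_def by blast
  obtain N where N: "op_subgroup M (G \<union> K) N" "acc_submodules M (G \<union> K) N" "B \<subseteq> N"
    using acc_submodules_adjoin_finite[OF assms(3) B(1,2) assms(4,5)] by blast
  have GK: "G \<union> K \<subseteq> carrier R" using assms(5) subfieldE(3)[OF assms(3)] by auto
  have N': "op_subgroup M (carrier R) N"
    using op_subgroup_generate_ring[OF N(1) GK] assms(6) by (simp add: Un_commute)
  have "carrier M \<subseteq> N"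
  proof
    fix x assume "x \<in> carrier M"
    then obtain c where c: "c \<in> B \<rightarrow> carrier R" "x = (\<Oplus>\<^bsub>M\<^esub>b\<in>B. c b \<odot>\<^bsub>M\<^esub> b)" using B(3) by blast
    show "x \<in> N" unfolding c(2)
      by (rule M.additive_subgroup_finsum_closed)
        (use N' N(3) c(1) in \<open>auto simp: op_subgroup_def Pi_iff subset_iff\<close>)
  qed
  then have "carrier M = N" using op_subgroupD(1)[OF N'] by blast
  \<comment> \<open>More operators mean fewer admissible subgroups, so the chain condition passes
    from \<open>G \<union> K\<close> to \<open>carrier R\<close>.\<close>
  moreover have "acc_submodules M (carrier R) N"
    using N(2) GK unfolding acc_submodules_def op_subgroup_def by (meson subsetD)
  ultimately show ?thesis by simp
qed

section \<open>Powers of ideals\<close>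

context cring begin

lemma ideal_pow_ideal:
  assumes "ideal J R"
  shows "ideal (J [^]\<^bsub>ideals_set R\<^esub> (k::nat)) R"
proof -
  interpret I: comm_monoid "ideals_set R" by (rule ideals_set_is_comm_monoid)
  show ?thesis using I.nat_pow_closed[of J k] assms by (simp add: ideals_set_def)
qed

lemma mult_mem_ideal_pow:
  assumes "ideal J R" "a \<in> J [^]\<^bsub>ideals_set R\<^esub> (k::nat)" "b \<in> J [^]\<^bsub>ideals_set R\<^esub> (l::nat)"
  shows "a \<otimes> b \<in> J [^]\<^bsub>ideals_set R\<^esub> (k + l)"
proof -
  interpret I: comm_monoid "ideals_set R" by (rule ideals_set_is_comm_monoid)
  have "J [^]\<^bsub>ideals_set R\<^esub> (k + l) = ideal_prod R (J [^]\<^bsub>ideals_set R\<^esub> k) (J [^]\<^bsub>ideals_set R\<^esub> l)"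
    using I.nat_pow_mult[of J k l] assms(1) by (simp add: ideals_set_def)
  then show ?thesis using ideal_prod.prod[OF assms(2,3)] by simp
qed

lemma ideal_pow_antimono:
  assumes "ideal J R" "k \<le> l"
  shows "J [^]\<^bsub>ideals_set R\<^esub> (l::nat) \<subseteq> J [^]\<^bsub>ideals_set R\<^esub> (k::nat)"
proof -
  interpret I: comm_monoid "ideals_set R" by (rule ideals_set_is_comm_monoid)
  have "J [^]\<^bsub>ideals_set R\<^esub> (k + (l - k)) =
      ideal_prod R (J [^]\<^bsub>ideals_set R\<^esub> k) (J [^]\<^bsub>ideals_set R\<^esub> (l - k))"
    using I.nat_pow_mult[of J k "l - k"] assms(1) by (simp add: ideals_set_def)
  moreover have "k + (l - k) = l" using assms(2) by simp
  ultimately show ?thesis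
    using ideal_prod_inter[OF ideal_pow_ideal[OF assms(1)] ideal_pow_ideal[OF assms(1)], of k "l - k"]
    by simp
qed

lemma ideals_set_one: "\<one>\<^bsub>ideals_set R\<^esub> = carrier R"
  by (simp add: ideals_set_def)

lemma ideals_set_mult: "J \<otimes>\<^bsub>ideals_set R\<^esub> K = ideal_prod R J K"
  by (simp add: ideals_set_def)

lemma pow_mem_ideal_pow:
  assumes "ideal J R" "a \<in> J"
  shows "a [^] k \<in> J [^]\<^bsub>ideals_set R\<^esub> (k::nat)"
proof (induction k)
  case 0
  then show ?case by (simp add: ideals_set_one)
next
  case (Suc k)
  then show ?case by (simp add: ideals_set_mult ideal_prod.prod assms(2))
qed

lemma pow_mem_ideal:
  assumes "ideal J R" "a \<in> J" "1 \<le> (q::nat)"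
  shows "a [^] q \<in> J"
proof -
  obtain q' where "q = Suc q'" using assms(3) by (cases q) auto
  then show ?thesis using ideal.I_l_closed[OF assms(1,2)] ideal.Icarr[OF assms(1,2)] by simp
qed

lemma ideal_colon:
  assumes "ideal C R" "a \<in> carrier R"
  shows "ideal {r \<in> carrier R. a \<otimes> r \<in> C} R"
proof -
  interpret C: ideal C R by fact
  show ?thesis
  proof (rule idealI[OF ring_axioms])
    have "additive_subgroup {r \<in> carrier R. a \<otimes> r \<in> C} R"
      by (rule additive_subgroup_closureI) (use assms(2) in \<open>auto simp: r_distr r_minus C.a_inv_closed\<close>)
    then show "subgroup {r \<in> carrier R. a \<otimes> r \<in> C} (add_monoid R)"
      by (rule additive_subgroup.a_subgroup)
  next
    fix r x assume r: "r \<in> {r \<in> carrier R. a \<otimes> r \<in> C}" and x: "x \<in> carrier R"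
    have "a \<otimes> (r \<otimes> x) \<in> C" using r x assms(2) C.I_r_closed by (simp add: m_assoc[symmetric])
    then show "x \<otimes> r \<in> {r \<in> carrier R. a \<otimes> r \<in> C}" "r \<otimes> x \<in> {r \<in> carrier R. a \<otimes> r \<in> C}"
      using r x by (auto simp: m_comm)
  qed
qed

section \<open>Monomials and powers of a finitely generated ideal\<close>

definition monomial :: "'a set \<Rightarrow> ('a \<Rightarrow> nat) \<Rightarrow> 'a" where
  "monomial G \<alpha> = (\<Otimes>g\<in>G. g [^] \<alpha> g)"

lemma monomial_closed: "G \<subseteq> carrier R \<Longrightarrow> monomial G \<alpha> \<in> carrier R"
  unfolding monomial_def by (auto intro!: finprod_closed)

lemma monomial_mem_ideal_pow:
  assumes J: "ideal J R" and "finite G" "G \<subseteq> J"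
  shows "monomial G \<alpha> \<in> J [^]\<^bsub>ideals_set R\<^esub> sum \<alpha> G"
  using assms(2,3)
proof (induction G)
  case empty
  then show ?case by (simp add: ideals_set_one monomial_def)
next
  case (insert g G)
  have "G \<subseteq> carrier R" "g \<in> carrier R" using insert ideal.Icarr[OF J] by auto
  then have "monomial (insert g G) \<alpha> = g [^] \<alpha> g \<otimes> monomial G \<alpha>"
    using insert by (auto simp: monomial_def intro!: finprod_insert)
  moreover have "g [^] \<alpha> g \<in> J [^]\<^bsub>ideals_set R\<^esub> \<alpha> g" using pow_mem_ideal_pow[OF J] insert by auto
  ultimately show ?case using mult_mem_ideal_pow[OF J] insert by simp
qed

lemma monomial_incr:
  assumes "finite G" "G \<subseteq> carrier R" "g \<in> G"
  shows "monomial G (\<alpha>(g := Suc (\<alpha> g))) = g \<otimes> monomial G \<alpha>"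
proof -
  have *: "monomial G \<beta> = g [^] \<beta> g \<otimes> monomial (G - {g}) \<beta>" for \<beta>
    using finprod_insert[of "G - {g}" g "\<lambda>g. g [^] \<beta> g"] assms
    by (auto simp: monomial_def insert_absorb)
  have "monomial (G - {g}) (\<alpha>(g := Suc (\<alpha> g))) = monomial (G - {g}) \<alpha>"
    unfolding monomial_def by (rule finprod_cong') (use assms in auto)
  moreover have "g \<in> carrier R" "monomial (G - {g}) \<alpha> \<in> carrier R"
    using assms by (auto intro!: monomial_closed)
  ultimately show ?thesis using *[of \<alpha>] *[of "\<alpha>(g := Suc (\<alpha> g))"] by (simp add: m_ac)
qed

text \<open>The monomials of degree \<open>k\<close> generate the \<open>k\<close>-th power. Stated
  as a containment test, this requires no description of the elements of the power: products are
  handled by colon ideals. The induction hypothesis is applied to such a colon ideal, hence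
  \<open>C\<close> is arbitrary.\<close>

lemma ideal_pow_subset:
  assumes G: "finite G" "G \<subseteq> carrier R" and "ideal C R"
    and "\<And>\<alpha>. sum \<alpha> G = k \<Longrightarrow> monomial G \<alpha> \<in> C"
  shows "(Idl G) [^]\<^bsub>ideals_set R\<^esub> k \<subseteq> C"
  using assms(3,4)
proof (induction k arbitrary: C)
  case 0
  have "\<one> \<in> C" using 0(2)[of "\<lambda>_. 0"] by (simp add: monomial_def)
  then show ?case using ideal.one_imp_carrier[OF 0(1)] by (simp add: ideals_set_one)
next
  case (Suc k)
  have I: "ideal (Idl G) R" using genideal_ideal[OF G(2)] .
  show ?case
  proof
    fix z assume "z \<in> (Idl G) [^]\<^bsub>ideals_set R\<^esub> Suc k"
    then have "z \<in> ideal_prod R ((Idl G) [^]\<^bsub>ideals_set R\<^esub> k) (Idl G)" by (simp add: ideals_set_mult)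
    then show "z \<in> C"
    proof induction
      case (prod i j)
      have i: "i \<in> carrier R" using prod(1) ideal.Icarr[OF ideal_pow_ideal[OF I]] by blast
      \<comment> \<open>Two passages to colon ideals: with a generator \<open>g\<close> fixed, the
        hypothesis for the colon of \<open>C\<close> by \<open>g\<close> gives
        \<open>g \<otimes> i \<in> C\<close>; then \<open>i\<close> is fixed and the other factor
        extends from \<open>G\<close> to \<open>Idl G\<close>.\<close>
      have "G \<subseteq> {r \<in> carrier R. i \<otimes> r \<in> C}"
      proof
        fix g assume g: "g \<in> G"
        then have gR: "g \<in> carrier R" using G by auto
        have "(Idl G) [^]\<^bsub>ideals_set R\<^esub> k \<subseteq> {r \<in> carrier R. g \<otimes> r \<in> C}"
        proof (rule Suc.IH[OF ideal_colon[OF Suc.prems(1) gR]])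
          fix \<alpha> assume \<alpha>: "sum \<alpha> G = k"
          have "sum (\<alpha>(g := Suc (\<alpha> g))) G = Suc k"
            using \<alpha> g G(1) by (simp add: sum.remove)
          then have "monomial G (\<alpha>(g := Suc (\<alpha> g))) \<in> C" by (rule Suc.prems(2))
          then show "monomial G \<alpha> \<in> {r \<in> carrier R. g \<otimes> r \<in> C}"
            using monomial_incr[OF G g] monomial_closed[OF G(2)] by simp
        qed
        then show "g \<in> {r \<in> carrier R. i \<otimes> r \<in> C}" using prod(1) i gR by (auto simp: m_comm)
      qed
      then have "Idl G \<subseteq> {r \<in> carrier R. i \<otimes> r \<in> C}"
        by (rule genideal_minimal[OF ideal_colon[OF Suc.prems(1) i]])
      then show ?case using prod(2) by auto
    next
      case (sum s1 s2)
      then show ?case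
        using additive_subgroup.a_closed[OF ideal.axioms(1)[OF Suc.prems(1)]] by simp
    qed
  qed
qed

lemma monomial_add:
  assumes "G \<subseteq> carrier R"
  shows "monomial G (\<lambda>g. \<alpha> g + \<beta> g) = monomial G \<alpha> \<otimes> monomial G \<beta>"
proof -
  have "monomial G (\<lambda>g. \<alpha> g + \<beta> g) = (\<Otimes>g\<in>G. g [^] \<alpha> g \<otimes> g [^] \<beta> g)"
    unfolding monomial_def by (rule finprod_cong') (use assms in \<open>auto simp: nat_pow_mult subset_iff\<close>)
  then show ?thesis
    using assms by (simp add: monomial_def finprod_multf Pi_iff subset_iff)
qed

lemma monomial_pow:
  assumes "G \<subseteq> carrier R"
  shows "monomial G (\<lambda>g. \<alpha> g * n) = monomial G \<alpha> [^] n"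
proof (induction n)
  case 0
  then show ?case by (simp add: monomial_def)
next
  case (Suc n)
  have "monomial G (\<lambda>g. \<alpha> g * Suc n) = monomial G (\<lambda>g. \<alpha> g * n + \<alpha> g)" by (simp add: add.commute)
  then show ?case using Suc monomial_add[OF assms] by simp
qed

text \<open>Divide every exponent by \<open>q\<close>. The remainders add up to at most
  \<open>card G * q\<close>, so of the degree \<open>(b + card G) * q\<close> at least
  \<open>b * q\<close> is left for the quotients. Hence the monomial is a multiple of the
  \<open>q\<close>-th power of a monomial in the \<open>b\<close>-th power of the ideal.\<close>

lemma ideal_pow_subset_of_frobenius:
  assumes G: "finite G" "G \<subseteq> carrier R" and C: "ideal C R" and q: "1 \<le> q"
    and pow: "\<And>u. u \<in> (Idl G) [^]\<^bsub>ideals_set R\<^esub> (b::nat) \<Longrightarrow> u [^] q \<in> C"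
  shows "(Idl G) [^]\<^bsub>ideals_set R\<^esub> ((b + card G) * q) \<subseteq> C"
proof (rule ideal_pow_subset[OF G C])
  fix \<alpha> assume \<alpha>: "sum \<alpha> G = (b + card G) * q"
  have I: "ideal (Idl G) R" using genideal_ideal[OF G(2)] .
  let ?u = "monomial G (\<lambda>g. \<alpha> g div q)" and ?v = "monomial G (\<lambda>g. \<alpha> g mod q)"
  have "(\<Sum>g\<in>G. \<alpha> g mod q) \<le> (\<Sum>g\<in>G. q)"
    by (rule sum_mono) (use q in \<open>simp add: less_imp_le\<close>)
  then have "(\<Sum>g\<in>G. \<alpha> g mod q) \<le> card G * q" by simp
  moreover have "sum \<alpha> G = (\<Sum>g\<in>G. \<alpha> g div q) * q + (\<Sum>g\<in>G. \<alpha> g mod q)"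
    by (simp add: sum_distrib_right sum.distrib[symmetric])
  ultimately have "b * q \<le> (\<Sum>g\<in>G. \<alpha> g div q) * q"
    using \<alpha> unfolding add_mult_distrib by linarith
  then have "b \<le> (\<Sum>g\<in>G. \<alpha> g div q)" using q by simp
  then have "?u \<in> (Idl G) [^]\<^bsub>ideals_set R\<^esub> b"
    using monomial_mem_ideal_pow[OF I G(1) genideal_self[OF G(2)]] ideal_pow_antimono[OF I] by blast
  then have "?u [^] q \<in> C" by (rule pow)
  then have "?u [^] q \<otimes> ?v \<in> C" using ideal.I_r_closed[OF C] monomial_closed[OF G(2)] by blast
  moreover have "monomial G \<alpha> = ?u [^] q \<otimes> ?v"
    using monomial_add[OF G(2), of "\<lambda>g. \<alpha> g div q * q" "\<lambda>g. \<alpha> g mod q"] monomial_pow[OF G(2)]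
    by simp
  ultimately show "monomial G \<alpha> \<in> C" by simp
qed

end

section \<open>The irrelevant ideal\<close>

context abelian_group begin

text \<open>The sum of a family of subgroups, in the same form as \<open>irrelevant_ideal\<close>,
  which is the case \<open>K = {1..}\<close>. The case \<open>K = UNIV\<close> yields the auxiliary
  subring \<open>V\<close> below.\<close>

definition finsums :: "'i set \<Rightarrow> ('i \<Rightarrow> 'a set) \<Rightarrow> 'a set" where
  "finsums K Y = {(\<Oplus>n\<in>N. f n) | f N. finite N \<and> N \<subseteq> K \<and> (\<forall>n\<in>N. f n \<in> Y n)}"

lemma additive_subgroup_finsums:
  assumes Y: "\<And>n. n \<in> K \<Longrightarrow> additive_subgroup (Y n) G"
  shows "additive_subgroup (finsums K Y) G"
proof (rule additive_subgroup_closureI)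
  have Yc: "x \<in> carrier G" if "n \<in> K" "x \<in> Y n" for n x
    using additive_subgroup.a_subset[OF Y[OF that(1)]] that(2) by auto
  show "finsums K Y \<subseteq> carrier G"
    unfolding finsums_def by (auto intro!: finsum_closed simp: Yc subset_iff)
  show "\<zero> \<in> finsums K Y"
    unfolding finsums_def by (auto intro!: exI[of _ "{}"])
  fix x assume "x \<in> finsums K Y"
  then obtain f N where f: "finite N" "N \<subseteq> K" "\<And>n. n \<in> N \<Longrightarrow> f n \<in> Y n" "x = (\<Oplus>n\<in>N. f n)"
    unfolding finsums_def by auto
  have fc: "f \<in> N \<rightarrow> carrier G" using f Yc by blast
  have "(\<Oplus>n\<in>N. \<ominus> f n) \<oplus> x = (\<Oplus>n\<in>N. \<ominus> f n \<oplus> f n)"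
    unfolding f(4) by (rule finsum_addf[symmetric]) (use fc in auto)
  also have "\<dots> = \<zero>"
    by (rule add.finprod_one_eqI) (use fc in \<open>auto intro!: l_neg\<close>)
  finally have "\<ominus> x = (\<Oplus>n\<in>N. \<ominus> f n)"
    using fc f(4) by (intro minus_equality) (auto intro!: finsum_closed)
  then show "\<ominus> x \<in> finsums K Y"
    unfolding finsums_def using f additive_subgroup_minus_closed[OF Y] by blast
  fix y assume "y \<in> finsums K Y"
  then obtain g N' where g: "finite N'" "N' \<subseteq> K" "\<And>n. n \<in> N' \<Longrightarrow> g n \<in> Y n" "y = (\<Oplus>n\<in>N'. g n)"
    unfolding finsums_def by auto
  have gc: "g \<in> N' \<rightarrow> carrier G" using g Yc by blast
  \<comment> \<open>Both families are extended by zero to the union of their index sets, so that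
    they can be added termwise.\<close>
  define f' where "f' n = (if n \<in> N then f n else \<zero>)" for n
  define g' where "g' n = (if n \<in> N' then g n else \<zero>)" for n
  have "x = (\<Oplus>n\<in>N\<union>N'. f' n)" unfolding f(4)
    by (rule add.finprod_mono_neutral_cong_left) (use f g fc in \<open>auto simp: f'_def\<close>)
  moreover have "y = (\<Oplus>n\<in>N\<union>N'. g' n)" unfolding g(4)
    by (rule add.finprod_mono_neutral_cong_left) (use f g gc in \<open>auto simp: g'_def\<close>)
  moreover have "f' \<in> N \<union> N' \<rightarrow> carrier G" "g' \<in> N \<union> N' \<rightarrow> carrier G"
    using fc gc by (auto simp: f'_def g'_def)
  ultimately have "x \<oplus> y = (\<Oplus>n\<in>N\<union>N'. f' n \<oplus> g' n)"
    by (simp add: finsum_addf)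
  moreover have "f' n \<oplus> g' n \<in> Y n" if "n \<in> N \<union> N'" for n
  proof -
    have n: "n \<in> K" using that f g by auto
    then show ?thesis
      using f(3)[of n] g(3)[of n] additive_subgroup.zero_closed[OF Y[OF n]]
        additive_subgroup.a_closed[OF Y[OF n]] by (auto simp: f'_def g'_def)
  qed
  ultimately show "x \<oplus> y \<in> finsums K Y"
    unfolding finsums_def using f(1,2) g(1,2)
    by (intro CollectI exI[of _ "\<lambda>n. f' n \<oplus> g' n"] exI[of _ "N \<union> N'"]) auto
qed

lemma subset_finsums:
  assumes "n \<in> K" "additive_subgroup (Y n) G"
  shows "Y n \<subseteq> finsums K Y"
proof
  fix x assume x: "x \<in> Y n"
  then have "x \<in> carrier G" using additive_subgroup.a_subset[OF assms(2)] by auto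
  then have "x = (\<Oplus>i\<in>{n}. x)" by simp
  then show "x \<in> finsums K Y"
    unfolding finsums_def using x assms(1)
    by (intro CollectI exI[of _ "\<lambda>_. x"] exI[of _ "{n}"]) auto
qed

lemma finsums_minimal:
  assumes "additive_subgroup H G" "\<And>n. n \<in> K \<Longrightarrow> Y n \<subseteq> H"
  shows "finsums K Y \<subseteq> H"
  unfolding finsums_def using assms(2) by (auto intro!: additive_subgroup_finsum_closed[OF assms(1)])

end

context cring begin

text \<open>Makes a claim about products additive in one factor, so that it need only be checked on
  homogeneous components.\<close>

lemma additive_subgroup_colon:
  assumes H: "additive_subgroup H R" and y: "y \<in> carrier R"
  shows "additive_subgroup {r \<in> carrier R. r \<otimes> y \<in> H} R"
  by (rule additive_subgroup_closureI)
    (use y additive_subgroup.zero_closed[OF H] additive_subgroup.a_closed[OF H]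
      additive_subgroup_minus_closed[OF H] in \<open>auto simp: l_distr l_minus\<close>)

lemma irrelevant_ideal_eq_finsums: "irrelevant_ideal R A = finsums {1..} A"
  by (simp add: irrelevant_ideal_def finsums_def)

text \<open>The inclusion from left to right needs every homogeneous element of positive degree to
  lie in \<open>Idl G\<close>. The sums whose parts of positive degree lie in \<open>Idl G\<close>
  form a subring \<open>V\<close> that contains all ring generators, so \<open>V\<close> is the
  whole ring; uniqueness of homogeneous components then gives the claim. The other inclusion needs
  the irrelevant ideal to be an ideal.\<close>

lemma irrelevant_ideal_eq_genideal:
  assumes dec: "direct_decomposition R A"
    and mult: "\<And>i j a b. a \<in> A i \<Longrightarrow> b \<in> A j \<Longrightarrow> a \<otimes> b \<in> A (i + j)"
    and A0: "subring (A 0) R"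
    and G: "G \<subseteq> A 1" and gen: "generate_ring R (A 0 \<union> G) = carrier R"
  shows "irrelevant_ideal R A = Idl G"
proof
  let ?m = "irrelevant_ideal R A"
  have A: "additive_subgroup (A n) R" for n using dec unfolding direct_decomposition_def by blast
  have Ac: "A n \<subseteq> carrier R" for n using additive_subgroup.a_subset[OF A] .
  have GR: "G \<subseteq> carrier R" using G Ac by blast
  have E: "ideal (Idl G) R" using genideal_ideal[OF GR] .
  have m: "additive_subgroup ?m R"
    unfolding irrelevant_ideal_eq_finsums by (rule additive_subgroup_finsums) (rule A)
  have mc: "?m \<subseteq> carrier R" using additive_subgroup.a_subset[OF m] .
  have Am: "A n \<subseteq> ?m" if "1 \<le> n" for n
    unfolding irrelevant_ideal_eq_finsums by (rule subset_finsums) (use A that in auto)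
  \<comment> \<open>Degree zero is left unrestricted because \<open>V\<close> has to contain the
    generators in \<open>A 0\<close>.\<close>
  define Y where "Y n = (if n = 0 then A 0 else A n \<inter> Idl G)" for n :: nat
  have Y: "additive_subgroup (Y n) R" for n
    by (rule additive_subgroup_closureI)
      (use A[of n] E Ac[of n] additive_subgroup.zero_closed[of _ R] additive_subgroup.a_closed[of _ R]
         additive_subgroup_minus_closed ideal.axioms(1)[OF E] in \<open>auto simp: Y_def\<close>)
  define V where "V = finsums UNIV Y"
  have V: "additive_subgroup V R" unfolding V_def by (rule additive_subgroup_finsums) (rule Y)
  have Vc: "V \<subseteq> carrier R" using additive_subgroup.a_subset[OF V] .
  have YV: "Y n \<subseteq> V" for n unfolding V_def by (rule subset_finsums) (use Y in auto)
  have YY: "a \<otimes> b \<in> V" if "a \<in> Y i" "b \<in> Y j" for a b i j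
  proof -
    have ab: "a \<in> A i" "b \<in> A j" using that by (auto simp: Y_def split: if_splits)
    then have "a \<in> carrier R" "b \<in> carrier R" using Ac by auto
    then have "a \<otimes> b \<in> Y (i + j)"
      using that mult[OF ab] ideal.I_l_closed[OF E] ideal.I_r_closed[OF E]
      by (auto simp: Y_def split: if_splits)
    then show ?thesis using YV by blast
  qed
  have V_mult: "a \<otimes> b \<in> V" if a: "a \<in> V" and b: "b \<in> V" for a b
  proof -
    \<comment> \<open>Closure under products is bilinear: first one factor is homogeneous and the
      other is decomposed, then the first factor is decomposed as well.\<close>
    have Yb: "x \<otimes> b \<in> V" if x: "x \<in> Y i" for x i
    proof -
      have xc: "x \<in> carrier R" using x YV Vc by blast
      have "finsums UNIV Y \<subseteq> {r \<in> carrier R. r \<otimes> x \<in> V}"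
        by (rule finsums_minimal[OF additive_subgroup_colon[OF V xc]]) (use YY[OF _ x] YV Vc in blast)
      then have "b \<otimes> x \<in> V" using b V_def by auto
      then show ?thesis using m_comm[of x b] xc b Vc by auto
    qed
    have bc: "b \<in> carrier R" using b Vc by auto
    have "finsums UNIV Y \<subseteq> {r \<in> carrier R. r \<otimes> b \<in> V}"
      by (rule finsums_minimal[OF additive_subgroup_colon[OF V bc]]) (use Yb YV Vc in blast)
    then show ?thesis using a V_def by auto
  qed
  have "subring V R"
  proof (rule subringI[OF Vc])
    have "\<one> \<in> Y 0" using subringE(3)[OF A0] by (simp add: Y_def)
    then show "\<one> \<in> V" using YV by blast
  qed (use V_mult additive_subgroup_minus_closed[OF V] additive_subgroup.a_closed[OF V] in auto)
  moreover have "A 0 \<union> G \<subseteq> V"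
  proof -
    have "A 0 = Y 0" "G \<subseteq> Y 1" using G genideal_self[OF GR] by (auto simp: Y_def)
    then show ?thesis using YV by blast
  qed
  ultimately have "carrier R \<subseteq> V"
    using generate_ring_min_subring1[of "A 0 \<union> G" V] Ac GR gen by auto
  have "A n \<subseteq> Idl G" if n: "1 \<le> n" for n
  proof
    fix a assume a: "a \<in> A n"
    then have ac: "a \<in> carrier R" using Ac by auto
    then have "a \<in> V" using \<open>carrier R \<subseteq> V\<close> by auto
    then obtain f N where f: "finite N" "\<And>i. i \<in> N \<Longrightarrow> f i \<in> Y i" "a = (\<Oplus>i\<in>N. f i)"
      unfolding V_def finsums_def by auto
    \<comment> \<open>Uniqueness in \<open>direct_decomposition\<close> concerns families on all of
      \<open>nat\<close>: \<open>f'\<close> extends the sum found in \<open>V\<close> by zero, and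
      \<open>g\<close> is \<open>a\<close> alone in degree \<open>n\<close>. Comparing them at
      \<open>n\<close> puts \<open>a\<close> into \<open>Y n\<close>.\<close>
    define f' where "f' i = (if i \<in> N then f i else \<zero>)" for i
    define g where "g i = (if i = n then a else \<zero>)" for i
    have f': "f' i \<in> Y i" for i using f(2) additive_subgroup.zero_closed[OF Y] by (simp add: f'_def)
    have f'A: "f' i \<in> A i" for i using f'[of i] by (auto simp: Y_def split: if_splits)
    have fin: "finite {i. f' i \<noteq> \<zero>}" "finite {i. g i \<noteq> \<zero>}"
      by (rule finite_subset[OF _ f(1)], auto simp: f'_def) (rule finite_subset[of _ "{n}"], auto simp: g_def)
    have "f \<in> N \<rightarrow> carrier R" using f(2) YV Vc by blast
    then have "a = (\<Oplus>i\<in>{i. f' i \<noteq> \<zero>}. f' i)" unfolding f(3)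
      by (intro add.finprod_mono_neutral_cong_right[OF f(1)]) (auto simp: f'_def split: if_splits)
    moreover have "a = (\<Oplus>i\<in>{i. g i \<noteq> \<zero>}. g i)"
    proof (cases "a = \<zero>")
      case False
      then have "{i. g i \<noteq> \<zero>} = {n}" by (auto simp: g_def)
      then show ?thesis using ac by (simp add: g_def)
    qed (simp add: g_def)
    moreover have "g i \<in> A i" for i using a additive_subgroup.zero_closed[OF A] by (simp add: g_def)
    ultimately have "f' = g"
      using dec ac f'A fin unfolding direct_decomposition_def by blast
    then have "a = f' n" by (simp add: g_def)
    then show "a \<in> Idl G" using f'[of n] n by (simp add: Y_def)
  qed
  then show "?m \<subseteq> Idl G"
    unfolding irrelevant_ideal_eq_finsums by (intro finsums_minimal[OF ideal.axioms(1)[OF E]]) auto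
  have lm: "x \<otimes> y \<in> ?m" if y: "y \<in> ?m" and x: "x \<in> carrier R" for x y
  proof -
    have yc: "y \<in> carrier R" using y mc by auto
    have *: "r \<otimes> y \<in> ?m" if r: "r \<in> A j" for r j
    proof -
      have rc: "r \<in> carrier R" using r Ac by auto
      have "finsums {1..} A \<subseteq> {s \<in> carrier R. s \<otimes> r \<in> ?m}"
      proof (rule finsums_minimal[OF additive_subgroup_colon[OF m rc]])
        show "A n \<subseteq> {s \<in> carrier R. s \<otimes> r \<in> ?m}" if "n \<in> {1..}" for n
          using mult[OF _ r, of _ n] Am[of "n + j"] that Ac by auto
      qed
      then have "y \<otimes> r \<in> ?m" using y by (auto simp: irrelevant_ideal_eq_finsums)
      then show ?thesis using m_comm[OF rc yc] by simp
    qed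
    \<comment> \<open>\<open>V\<close> is already known to be the whole ring, so by additivity
      homogeneous multipliers suffice.\<close>
    have "V \<subseteq> {r \<in> carrier R. r \<otimes> y \<in> ?m}"
      unfolding V_def
    proof (rule finsums_minimal[OF additive_subgroup_colon[OF m yc]])
      show "Y n \<subseteq> {r \<in> carrier R. r \<otimes> y \<in> ?m}" for n
        using *[of _ n] Ac[of n] by (auto simp: Y_def split: if_splits)
    qed
    then show ?thesis using x \<open>carrier R \<subseteq> V\<close> by auto
  qed
  have "ideal ?m R"
  proof (rule idealI[OF ring_axioms additive_subgroup.a_subgroup[OF m]])
    fix a x assume "a \<in> ?m" "x \<in> carrier R"
    then show "x \<otimes> a \<in> ?m" "a \<otimes> x \<in> ?m" using lm[of a x] m_comm[of a x] mc by auto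
  qed
  moreover have "G \<subseteq> ?m" using G Am[of 1] by auto
  ultimately show "Idl G \<subseteq> ?m" by (rule genideal_minimal)
qed

end

section \<open>Frobenius powers and decompositions of the Frobenius module\<close>

context cring begin

lemma ideal_frobenius_power:
  assumes "ideal I R"
  shows "ideal (frobenius_power R I (q::nat)) R"
  unfolding frobenius_power_def using ideal.Icarr[OF assms] by (intro genideal_ideal) auto

lemma pow_mem_frobenius_power:
  assumes I: "ideal I R" and "a \<in> I"
  shows "a [^] (q::nat) \<in> frobenius_power R I q"
proof -
  have "{a [^] q | a. a \<in> I} \<subseteq> carrier R" using ideal.Icarr[OF I] by auto
  then show ?thesis unfolding frobenius_power_def using genideal_self assms(2) by blast
qed

end

section \<open>The submodules I M and their torsion exponents\<close>

lemma op_subgroup_ideal_smult: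
  fixes R :: "('a, 'b) ring_scheme" (structure) and M :: "('a, 'm) module"
  assumes "module R M" "ideal I R"
  shows "op_subgroup M (carrier R) (ideal_smult M I (carrier M))"
proof -
  interpret module R M by fact
  let ?S = "{a \<odot>\<^bsub>M\<^esub> x | a x. a \<in> I \<and> x \<in> carrier M}"
  have I: "a \<in> carrier R" if "a \<in> I" for a using ideal.Icarr[OF assms(2) that] .
  have S: "?S \<subseteq> carrier M" using I by auto
  have sub: "additive_subgroup (ideal_smult M I (carrier M)) M"
    unfolding ideal_smult_def additive_subgroup_def by (rule M.add.generate_is_subgroup[OF S])
  have "s \<odot>\<^bsub>M\<^esub> x \<in> ideal_smult M I (carrier M)"
    if s: "s \<in> carrier R" and x: "x \<in> ideal_smult M I (carrier M)" for s x
    using x unfolding ideal_smult_def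
  proof induction
    case one
    then show ?case using s generate.one[of "add_monoid M" ?S] by simp
  next
    case (incl h)
    then obtain a y where h: "a \<in> I" "y \<in> carrier M" "h = a \<odot>\<^bsub>M\<^esub> y" by auto
    then have "s \<odot>\<^bsub>M\<^esub> h = (s \<otimes> a) \<odot>\<^bsub>M\<^esub> y" using s I by (simp add: smult_assoc1)
    moreover have "s \<otimes> a \<in> I" using ideal.I_l_closed[OF assms(2) h(1) s] .
    ultimately have "s \<odot>\<^bsub>M\<^esub> h \<in> ?S" using h by blast
    then show ?case by (rule generate.incl)
  next
    case (inv h)
    then obtain a y where h: "a \<in> I" "y \<in> carrier M" "h = a \<odot>\<^bsub>M\<^esub> y" by auto
    then have "s \<odot>\<^bsub>M\<^esub> h = (s \<otimes> a) \<odot>\<^bsub>M\<^esub> y" using s I by (simp add: smult_assoc1)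
    moreover have "s \<otimes> a \<in> I" using ideal.I_l_closed[OF assms(2) h(1) s] .
    ultimately have "s \<odot>\<^bsub>M\<^esub> h \<in> ?S" using h by blast
    moreover have "s \<odot>\<^bsub>M\<^esub> (inv\<^bsub>add_monoid M\<^esub> h) = inv\<^bsub>add_monoid M\<^esub> (s \<odot>\<^bsub>M\<^esub> h)"
      using smult_r_minus[OF s, of h] h I by (simp add: a_inv_def)
    ultimately show ?case using generate.inv[of "s \<odot>\<^bsub>M\<^esub> h" ?S "add_monoid M"] by simp
  next
    case (eng h1 h2)
    have "h1 \<in> carrier M" "h2 \<in> carrier M"
      using M.add.generate_in_carrier[OF S] eng(1,2) by blast+
    then show ?case using generate.eng[OF eng(3,4)] s by (simp add: smult_r_distr)
  qed
  then show ?thesis using sub by (simp add: op_subgroup_def)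
qed

context module begin

text \<open>The order of quantifiers is the point: one \<open>b\<close> serves all \<open>k\<close>
  and \<open>v\<close>. It is the index at which the ascending chain \<open>T\<close> of submodules
  becomes stationary.\<close>

lemma torsion_stable:
  assumes "acc_submodules M (carrier R) (carrier M)" "op_subgroup M (carrier R) P" "ideal J R"
  shows "\<exists>b::nat. \<forall>(k::nat) v. v \<in> carrier M \<longrightarrow> (\<forall>a \<in> J [^]\<^bsub>ideals_set R\<^esub> k. a \<odot>\<^bsub>M\<^esub> v \<in> P) \<longrightarrow>
    (\<forall>a \<in> J [^]\<^bsub>ideals_set R\<^esub> b. a \<odot>\<^bsub>M\<^esub> v \<in> P)"
proof -
  define T where "T k = {v \<in> carrier M. \<forall>a \<in> J [^]\<^bsub>ideals_set R\<^esub> k. a \<odot>\<^bsub>M\<^esub> v \<in> P}" for k :: nat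
  note P = op_subgroupD[OF assms(2)]
  have Jc: "a \<in> carrier R" if "a \<in> J [^]\<^bsub>ideals_set R\<^esub> k" for a and k :: nat
    using ideal.Icarr[OF ideal_pow_ideal[OF assms(3)] that] .
  have T: "op_subgroup M (carrier R) (T k)" for k
  proof (rule op_subgroupI)
    show "T k \<subseteq> carrier M" "\<zero>\<^bsub>M\<^esub> \<in> T k" using P(2) Jc by (auto simp: T_def)
    show "x \<oplus>\<^bsub>M\<^esub> y \<in> T k" if "x \<in> T k" "y \<in> T k" for x y
      using that P(3) Jc by (simp add: T_def smult_r_distr)
    show "\<ominus>\<^bsub>M\<^esub> x \<in> T k" if "x \<in> T k" for x
      using that P(4) Jc by (simp add: T_def smult_r_minus)
    show "s \<odot>\<^bsub>M\<^esub> x \<in> T k" if s: "s \<in> carrier R" and x: "x \<in> T k" for s x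
    proof -
      have "a \<odot>\<^bsub>M\<^esub> (s \<odot>\<^bsub>M\<^esub> x) \<in> P" if a: "a \<in> J [^]\<^bsub>ideals_set R\<^esub> k" for a
        using smult_left_commute[OF Jc[OF a] s] x a P(5)[OF s] by (simp add: T_def)
      then show ?thesis using s x by (simp add: T_def)
    qed
  qed
  have mono: "T k \<subseteq> T l" if "k \<le> l" for k l
    using ideal_pow_antimono[OF assms(3) that] unfolding T_def by blast
  have "\<exists>b. \<forall>n\<ge>b. T n = T b"
    by (rule acc_submodulesD[OF assms(1) T]) (use mono[of _ "Suc _"] in \<open>auto simp: T_def\<close>)
  then obtain b where b: "\<And>n. b \<le> n \<Longrightarrow> T n = T b" by blast
  have "T k \<subseteq> T b" for k using mono[of k "max k b"] b[of "max k b"] by simp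
  then show ?thesis unfolding T_def by blast
qed

end

text \<open>The isomorphism from F^n(R) to a direct sum, read one component at a time.
  \<open>h_smult\<close> carries the Frobenius twist: a scalar \<open>a\<close> on the right is
  multiplication by \<open>a [^] q\<close> on the left.\<close>

locale frobenius_decomposition = cring R for R (structure) +
  fixes q :: nat and Ix :: "'i set" and N :: "'i \<Rightarrow> ('a, 'm) module" and h :: "'a \<Rightarrow> 'i \<Rightarrow> 'm"
  assumes finite_Ix: "finite Ix" and module_N: "x \<in> Ix \<Longrightarrow> module R (N x)"
    and h_bij: "bij_betw h (carrier R) (\<Pi>\<^sub>E x\<in>Ix. carrier (N x))"
    and h_add: "\<lbrakk>r \<in> carrier R; s \<in> carrier R; x \<in> Ix\<rbrakk> \<Longrightarrow> h (r \<oplus> s) x = h r x \<oplus>\<^bsub>N x\<^esub> h s x"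
    and h_smult: "\<lbrakk>a \<in> carrier R; r \<in> carrier R; x \<in> Ix\<rbrakk> \<Longrightarrow> h (a [^] q \<otimes> r) x = a \<odot>\<^bsub>N x\<^esub> h r x"
begin

lemma h_closed: "r \<in> carrier R \<Longrightarrow> x \<in> Ix \<Longrightarrow> h r x \<in> carrier (N x)"
  using h_bij by (auto simp: bij_betw_def)

lemma h_eqI:
  assumes "r \<in> carrier R" "w \<in> (\<Pi>\<^sub>E x\<in>Ix. carrier (N x))" "\<And>x. x \<in> Ix \<Longrightarrow> h r x = w x"
  shows "h r = w"
proof (rule PiE_ext[of _ Ix "\<lambda>x. carrier (N x)"])
  show "h r \<in> (\<Pi>\<^sub>E x\<in>Ix. carrier (N x))" using h_bij assms(1) by (auto simp: bij_betw_def)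
qed (use assms in auto)

lemma h_surj:
  assumes "w \<in> (\<Pi>\<^sub>E x\<in>Ix. carrier (N x))"
  obtains r where "r \<in> carrier R" "h r = w"
  using assms h_bij unfolding bij_betw_def by (metis imageE)

lemma h_zero: "x \<in> Ix \<Longrightarrow> h \<zero> x = \<zero>\<^bsub>N x\<^esub>"
proof -
  assume x: "x \<in> Ix"
  interpret N: module R "N x" using module_N[OF x] .
  show ?thesis using h_add[of \<zero> \<zero> x] h_closed[of \<zero> x] x by (simp add: N.M.add.l_cancel_one')
qed

lemma h_minus:
  assumes "r \<in> carrier R" "x \<in> Ix"
  shows "h (\<ominus> r) x = \<ominus>\<^bsub>N x\<^esub> h r x"
proof -
  interpret N: module R "N x" using module_N[OF assms(2)] .
  have "h (\<ominus> r) x \<oplus>\<^bsub>N x\<^esub> h r x = \<zero>\<^bsub>N x\<^esub>"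
    using h_add[of "\<ominus> r" r x] assms h_zero by (simp add: l_neg)
  then show ?thesis using N.M.minus_equality h_closed assms by (metis a_inv_closed)
qed

text \<open>On a multiple \<open>s \<otimes> a [^] q\<close> of a generator, the component is
  \<open>a\<close> times \<open>h s x\<close>, with \<open>a \<in> I\<close>.\<close>

lemma frobenius_power_component:
  assumes I: "ideal I R" and r: "r \<in> frobenius_power R I q" and x: "x \<in> Ix"
  shows "h r x \<in> ideal_smult (N x) I (carrier (N x))"
proof -
  interpret N: module R "N x" using module_N[OF x] .
  note P = N.op_subgroupD[OF op_subgroup_ideal_smult[OF module_N[OF x] I]]
  let ?D = "{r \<in> carrier R. \<forall>s\<in>carrier R. h (s \<otimes> r) x \<in> ideal_smult (N x) I (carrier (N x))}"
  \<comment> \<open>\<open>h\<close> is only linear over \<open>q\<close>-th powers, hence the quantifier over \<open>s\<close> in \<open>?D\<close>\<close>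
  have "ideal ?D R"
  proof (rule idealI[OF ring_axioms])
    have "additive_subgroup ?D R"
      by (rule additive_subgroup_closureI) (use P x in \<open>auto simp: h_zero r_distr r_minus h_add h_minus\<close>)
    then show "subgroup ?D (add_monoid R)" by (rule additive_subgroup.a_subgroup)
    fix a y assume a: "a \<in> ?D" and y: "y \<in> carrier R"
    have "h (s \<otimes> (y \<otimes> a)) x \<in> ideal_smult (N x) I (carrier (N x))" if "s \<in> carrier R" for s
      using a y that by (simp add: m_assoc[symmetric])
    then show "y \<otimes> a \<in> ?D" using a y by simp
    then show "a \<otimes> y \<in> ?D" using a y by (simp add: m_comm)
  qed
  moreover have "{a [^] q | a. a \<in> I} \<subseteq> ?D"
  proof
    fix z assume "z \<in> {a [^] q | a. a \<in> I}"
    then obtain a where a: "a \<in> I" "z = a [^] q" by auto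
    then have ac: "a \<in> carrier R" using ideal.Icarr[OF I] by auto
    have "h (s \<otimes> z) x \<in> ideal_smult (N x) I (carrier (N x))" if s: "s \<in> carrier R" for s
    proof -
      have "h (s \<otimes> z) x = a \<odot>\<^bsub>N x\<^esub> h s x" using a ac s x h_smult by (simp add: m_comm)
      then show ?thesis
        unfolding ideal_smult_def using a h_closed[OF s x] by (auto intro!: generate.incl)
    qed
    then show "z \<in> ?D" using a ac by simp
  qed
  ultimately have "frobenius_power R I q \<subseteq> ?D" unfolding frobenius_power_def by (rule genideal_minimal)
  then have "r \<in> ?D" using r by auto
  then have "r \<in> carrier R" "h (\<one> \<otimes> r) x \<in> ideal_smult (N x) I (carrier (N x))" by blast+
  then show ?thesis by simp
qed

text \<open>The embedding of one summand into the direct sum. Restriction to \<open>Ix\<close> makes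
  the tuple extensional, so that it has a preimage under \<open>h\<close>.\<close>

definition single :: "'i \<Rightarrow> 'm \<Rightarrow> 'i \<Rightarrow> 'm" where
  "single x u = (\<lambda>y\<in>Ix. if y = x then u else \<zero>\<^bsub>N y\<^esub>)"

text \<open>For \<open>u = a \<odot> v\<close> with \<open>a \<in> I\<close>, let \<open>h r\<close>
  be the tuple with \<open>v\<close> at \<open>x\<close>; then \<open>a [^] q \<otimes> r\<close> is
  the required element. Sums and inverses of such \<open>u\<close> follow since \<open>h\<close> is
  additive.\<close>

lemma single_mem_image:
  assumes I: "ideal I R" and x: "x \<in> Ix" and u: "u \<in> ideal_smult (N x) I (carrier (N x))"
  shows "\<exists>r \<in> frobenius_power R I q. \<forall>y\<in>Ix. h r y = single x u y"
proof -
  let ?P = "frobenius_power R I q"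
  have P: "ideal ?P R" using ideal_frobenius_power[OF I] .
  note P' = additive_subgroup.zero_closed[OF ideal.axioms(1)[OF P]]
    additive_subgroup.a_closed[OF ideal.axioms(1)[OF P]]
    additive_subgroup_minus_closed[OF ideal.axioms(1)[OF P]] ideal.Icarr[OF P]
  have zero: "\<zero>\<^bsub>N y\<^esub> \<in> carrier (N y)" "\<zero>\<^bsub>N y\<^esub> \<oplus>\<^bsub>N y\<^esub> \<zero>\<^bsub>N y\<^esub> = \<zero>\<^bsub>N y\<^esub>" "\<ominus>\<^bsub>N y\<^esub> \<zero>\<^bsub>N y\<^esub> = \<zero>\<^bsub>N y\<^esub>"
    "a \<in> carrier R \<Longrightarrow> a \<odot>\<^bsub>N y\<^esub> \<zero>\<^bsub>N y\<^esub> = \<zero>\<^bsub>N y\<^esub>" if "y \<in> Ix" for y a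
  proof -
    interpret N: module R "N y" using module_N[OF that] .
    show "\<zero>\<^bsub>N y\<^esub> \<in> carrier (N y)" "\<zero>\<^bsub>N y\<^esub> \<oplus>\<^bsub>N y\<^esub> \<zero>\<^bsub>N y\<^esub> = \<zero>\<^bsub>N y\<^esub>" "\<ominus>\<^bsub>N y\<^esub> \<zero>\<^bsub>N y\<^esub> = \<zero>\<^bsub>N y\<^esub>"
      "a \<in> carrier R \<Longrightarrow> a \<odot>\<^bsub>N y\<^esub> \<zero>\<^bsub>N y\<^esub> = \<zero>\<^bsub>N y\<^esub>" by auto
  qed
  have gen: "\<exists>r \<in> ?P. \<forall>y\<in>Ix. h r y = single x (a \<odot>\<^bsub>N x\<^esub> v) y"
    if a: "a \<in> I" and v: "v \<in> carrier (N x)" for a v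
  proof -
    have "single x v \<in> (\<Pi>\<^sub>E y\<in>Ix. carrier (N y))" using v zero by (auto simp: single_def)
    then obtain r where r: "r \<in> carrier R" "h r = single x v" by (rule h_surj)
    have ac: "a \<in> carrier R" using ideal.Icarr[OF I a] .
    have "a [^] q \<otimes> r \<in> ?P"
      using ideal.I_r_closed[OF P pow_mem_frobenius_power[OF I a] r(1)] .
    moreover have "h (a [^] q \<otimes> r) y = single x (a \<odot>\<^bsub>N x\<^esub> v) y" if "y \<in> Ix" for y
      using h_smult[OF ac r(1) that] r(2) that zero(4)[OF that ac] by (simp add: single_def)
    ultimately show ?thesis by blast
  qed
  show ?thesis
    using u unfolding ideal_smult_def
  proof induction
    case one
    have "\<forall>y\<in>Ix. h \<zero> y = single x \<zero>\<^bsub>N x\<^esub> y" using h_zero by (simp add: single_def)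
    then show ?case using P'(1) by auto
  next
    case (incl u)
    then show ?case using gen by blast
  next
    case (inv u)
    then obtain r where r: "r \<in> ?P" "\<forall>y\<in>Ix. h r y = single x u y" using gen by blast
    have "h (\<ominus> r) y = single x (inv\<^bsub>add_monoid (N x)\<^esub> u) y" if "y \<in> Ix" for y
      using r h_minus[OF P'(4)[OF r(1)] that] that zero(3)[OF that]
      by (simp add: single_def a_inv_def)
    then show ?case using P'(3)[OF r(1)] by blast
  next
    case (eng u1 u2)
    then obtain r s where r: "r \<in> ?P" "\<forall>y\<in>Ix. h r y = single x u1 y"
      and s: "s \<in> ?P" "\<forall>y\<in>Ix. h s y = single x u2 y" by auto
    have "h (r \<oplus> s) y = single x (u1 \<otimes>\<^bsub>add_monoid (N x)\<^esub> u2) y" if "y \<in> Ix" for y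
      using r s h_add[OF P'(4)[OF r(1)] P'(4)[OF s(1)] that] that zero(2)[OF that]
      by (simp add: single_def)
    then show ?case using P'(2)[OF r(1) s(1)] by blast
  qed
qed

text \<open>Adding up preimages of the single components yields an element of the Frobenius power
  with the same image as \<open>r\<close>; injectivity of \<open>h\<close> identifies it with
  \<open>r\<close>.\<close>

lemma frobenius_powerI:
  assumes I: "ideal I R" and r: "r \<in> carrier R"
    and comp: "\<And>x. x \<in> Ix \<Longrightarrow> h r x \<in> ideal_smult (N x) I (carrier (N x))"
  shows "r \<in> frobenius_power R I q"
proof -
  let ?P = "frobenius_power R I q"
  have P: "ideal ?P R" using ideal_frobenius_power[OF I] .
  \<comment> \<open>The components of \<open>r\<close> are collected one index at a time, with zero
    at the indices outside \<open>Y\<close>.\<close>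
  have "\<exists>s \<in> ?P. \<forall>y\<in>Ix. h s y = (if y \<in> Y then h r y else \<zero>\<^bsub>N y\<^esub>)" if "Y \<subseteq> Ix" for Y
    using finite_subset[OF that finite_Ix] that
  proof (induction Y)
    case empty
    then show ?case using h_zero additive_subgroup.zero_closed[OF ideal.axioms(1)[OF P]] by auto
  next
    case (insert x Y)
    then obtain s where s: "s \<in> ?P" "\<forall>y\<in>Ix. h s y = (if y \<in> Y then h r y else \<zero>\<^bsub>N y\<^esub>)" by auto
    obtain t where t: "t \<in> ?P" "\<forall>y\<in>Ix. h t y = single x (h r x) y"
      using single_mem_image[OF I _ comp[of x]] insert by blast
    have "h (s \<oplus> t) y = (if y \<in> insert x Y then h r y else \<zero>\<^bsub>N y\<^esub>)" if y: "y \<in> Ix" for y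
    proof -
      interpret N: module R "N y" using module_N[OF y] .
      have "h (s \<oplus> t) y = h s y \<oplus>\<^bsub>N y\<^esub> h t y" using s t y ideal.Icarr[OF P] h_add by auto
      then show ?thesis using s t y insert(2) N.M.l_zero[OF h_closed[OF r y]] N.M.r_zero[OF h_closed[OF r y]]
        by (auto simp: single_def)
    qed
    then show ?case using additive_subgroup.a_closed[OF ideal.axioms(1)[OF P] s(1) t(1)] by blast
  qed
  from this[of Ix] obtain s where s: "s \<in> ?P" "\<forall>y\<in>Ix. h s y = h r y" by auto
  have "h s = h r"
    using h_bij r s by (intro h_eqI) (auto simp: bij_betw_def ideal.Icarr[OF P])
  then have "s = r" using h_bij r s(1) ideal.Icarr[OF P] by (auto simp: bij_betw_def inj_on_def)
  then show ?thesis using s by simp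
qed

text \<open>For \<open>c\<close> in the \<open>k\<close>-th power of \<open>J\<close>, also
  \<open>c [^] q\<close> is in it because \<open>q \<ge> 1\<close>. So \<open>c\<close> maps every
  component of \<open>r\<close> into the submodule given by \<open>I\<close>, and
  \<open>stable\<close> replaces \<open>k\<close> by \<open>b\<close>. Translating back turns
  \<open>a\<close> into \<open>a [^] q\<close>.\<close>

lemma frobenius_power_colon:
  fixes b k :: nat
  assumes I: "ideal I R" and J: "ideal J R" and q: "1 \<le> q"
    and stable: "\<And>x v. \<lbrakk>x \<in> Ix; v \<in> carrier (N x);
        \<forall>a \<in> J [^]\<^bsub>ideals_set R\<^esub> k. a \<odot>\<^bsub>N x\<^esub> v \<in> ideal_smult (N x) I (carrier (N x))\<rbrakk> \<Longrightarrow>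
      \<forall>a \<in> J [^]\<^bsub>ideals_set R\<^esub> b. a \<odot>\<^bsub>N x\<^esub> v \<in> ideal_smult (N x) I (carrier (N x))"
    and r: "r \<in> carrier R"
    and tors: "\<And>a. a \<in> J [^]\<^bsub>ideals_set R\<^esub> k \<Longrightarrow> a \<otimes> r \<in> frobenius_power R I q"
    and a: "a \<in> J [^]\<^bsub>ideals_set R\<^esub> b"
  shows "a [^] q \<otimes> r \<in> frobenius_power R I q"
proof (rule frobenius_powerI[OF I])
  have Jc: "a \<in> carrier R" if "a \<in> J [^]\<^bsub>ideals_set R\<^esub> k" for a and k :: nat
    using ideal.Icarr[OF ideal_pow_ideal[OF J] that] .
  show "a [^] q \<otimes> r \<in> carrier R" using Jc[OF a] r by simp
  fix x assume x: "x \<in> Ix"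
  have "c \<odot>\<^bsub>N x\<^esub> h r x \<in> ideal_smult (N x) I (carrier (N x))" if c: "c \<in> J [^]\<^bsub>ideals_set R\<^esub> k" for c
    using frobenius_power_component[OF I tors[OF pow_mem_ideal[OF ideal_pow_ideal[OF J] c q]] x]
      h_smult[OF Jc[OF c] r x] by simp
  then show "h (a [^] q \<otimes> r) x \<in> ideal_smult (N x) I (carrier (N x))"
    using stable[OF x h_closed[OF r x]] a h_smult[OF Jc[OF a] r x] by simp
qed

end

section \<open>Passage to the quotient module and assembly of the bound\<close>

lemma (in cring) ideal_smult_quotient_eq_zero:
  assumes P: "ideal P R" and J: "ideal J R" and m: "ideal m R"
    and ann: "\<And>(k::nat) r a. \<lbrakk>r \<in> carrier R; \<And>c. c \<in> m [^]\<^bsub>ideals_set R\<^esub> k \<Longrightarrow> c \<otimes> r \<in> P; a \<in> J\<rbrakk> \<Longrightarrow> a \<otimes> r \<in> P"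
  shows "ideal_smult (quotient_module R P) J (zeroth_local_cohomology R m (quotient_module R P)) =
    {\<zero>\<^bsub>quotient_module R P\<^esub>}"
proof -
  interpret P: ideal P R by fact
  interpret Q: ring "R Quot P" by (rule P.quotient_is_ring)
  let ?Q = "quotient_module R P"
  have Q: "carrier ?Q = carrier (R Quot P)" "\<zero>\<^bsub>?Q\<^esub> = P" "add ?Q = add (R Quot P)"
    "\<zero>\<^bsub>R Quot P\<^esub> = P"
    by (simp_all add: quotient_module_def ring.extend_def module.fields_def FactRing_def)
  have smult: "a \<odot>\<^bsub>?Q\<^esub> (P +> r) = P +> (a \<otimes> r)" if "a \<in> carrier R" "r \<in> carrier R" for a r
    using that P.rcoset_mult_add
    by (simp add: quotient_module_def ring.extend_def module.fields_def FactRing_def)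
  have eq: "P +> y = P \<longleftrightarrow> y \<in> P" if "y \<in> carrier R" for y
    using that a_coset_join1[of P y] a_coset_join2[of y P] P.a_subgroup by blast
  have gen: "{a \<odot>\<^bsub>?Q\<^esub> x | a x. a \<in> J \<and> x \<in> zeroth_local_cohomology R m ?Q} \<subseteq> {P}"
  proof clarify
    fix a x assume a: "a \<in> J" and x: "x \<in> zeroth_local_cohomology R m ?Q"
    then have "x \<in> a_rcosets P" by (simp add: zeroth_local_cohomology_def Q FactRing_def)
    then obtain r where r: "r \<in> carrier R" "x = P +> r" by (auto simp: A_RCOSETS_def')
    obtain k :: nat where k: "\<And>c. c \<in> m [^]\<^bsub>ideals_set R\<^esub> k \<Longrightarrow> c \<odot>\<^bsub>?Q\<^esub> x = P"
      using x by (auto simp: zeroth_local_cohomology_def Q)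
    have "c \<otimes> r \<in> P" if c: "c \<in> m [^]\<^bsub>ideals_set R\<^esub> k" for c
    proof -
      have "c \<in> carrier R" using ideal.Icarr[OF ideal_pow_ideal[OF m] c] .
      then show ?thesis using k[OF c] smult eq r by simp
    qed
    then have "a \<otimes> r \<in> P" using ann[OF r(1) _ a] by blast
    then show "a \<odot>\<^bsub>?Q\<^esub> x = P" using smult eq r ideal.Icarr[OF J a] by simp
  qed
  have "x = P" if "x \<in> ideal_smult ?Q J (zeroth_local_cohomology R m ?Q)" for x
    using that unfolding ideal_smult_def
  proof induction
    case one
    then show ?case by (simp add: Q)
  next
    case (incl h)
    then show ?case using gen by auto
  next
    case (inv h)
    then have "h = \<zero>\<^bsub>R Quot P\<^esub>" using gen Q(4) by auto
    moreover have "inv\<^bsub>add_monoid ?Q\<^esub> h = \<ominus>\<^bsub>R Quot P\<^esub> h"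
      by (simp add: a_inv_def m_inv_def Q)
    ultimately show ?case using Q.minus_zero Q(4) by simp
  next
    case (eng h1 h2)
    then show ?case using Q.l_zero[of P] Q.zero_closed Q(3,4) by simp
  qed
  moreover have "P \<in> ideal_smult ?Q J (zeroth_local_cohomology R m ?Q)"
    unfolding ideal_smult_def using generate.one[of "add_monoid ?Q"] Q(2) by simp
  ultimately show ?thesis unfolding Q(2) by blast
qed

lemma frobenius_decomposition_of_graded_isomorphic:
  assumes "cring R" "finite Ix" "\<And>x. x \<in> Ix \<Longrightarrow> module R (N x)"
    and "graded_isomorphic R (frobenius_module R p n) E (finite_direct_sum Ix N) D"
  obtains h where "frobenius_decomposition R (p ^ n) Ix N h"
proof -
  obtain h where h: "h \<in> iso (add_monoid (frobenius_module R p n)) (add_monoid (finite_direct_sum Ix N))"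
    "\<And>a r. a \<in> carrier R \<Longrightarrow> r \<in> carrier R \<Longrightarrow>
       h (a \<odot>\<^bsub>frobenius_module R p n\<^esub> r) = a \<odot>\<^bsub>finite_direct_sum Ix N\<^esub> h r"
    using assms(4) unfolding graded_isomorphic_def by (auto simp: frobenius_module_def)
  have "frobenius_decomposition R (p ^ n) Ix N h"
  proof (intro frobenius_decomposition.intro frobenius_decomposition_axioms.intro)
    show "bij_betw h (carrier R) (\<Pi>\<^sub>E x\<in>Ix. carrier (N x))"
      using h(1) by (simp add: iso_def frobenius_module_def finite_direct_sum_def)
    fix r s x assume "r \<in> carrier R" "s \<in> carrier R" "x \<in> Ix"
    then show "h (r \<oplus>\<^bsub>R\<^esub> s) x = h r x \<oplus>\<^bsub>N x\<^esub> h s x"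
      using h(1) by (simp add: iso_def hom_def frobenius_module_def finite_direct_sum_def)
  next
    fix a r x assume "a \<in> carrier R" "r \<in> carrier R" "x \<in> Ix"
    then show "h (a [^]\<^bsub>R\<^esub> (p ^ n) \<otimes>\<^bsub>R\<^esub> r) x = a \<odot>\<^bsub>N x\<^esub> h r x"
      using h(2)[of a r] by (simp add: frobenius_module_def finite_direct_sum_def)
  qed (use assms in auto)
  then show thesis by (rule that)
qed

theorem mainTheorem13:
  fixes R :: "('a, 'b) ring_scheme" and A :: "nat \<Rightarrow> 'a set" and p :: nat and I :: "'a set"
  assumes "standard_graded_ring R A"
    and "subfield (A 0) R"
    and "Factorial_Ring.prime p" and "[p] \<cdot>\<^bsub>R\<^esub> \<one>\<^bsub>R\<^esub> = \<zero>\<^bsub>R\<^esub>"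
    and "F_finite R p (A 0)"
    and "finite_F_representation_type TYPE('m) R A p"
    and "homogeneous_ideal R A I"
  shows "\<exists>b::nat. \<forall>n\<ge>1.
    (let Q = quotient_module R (frobenius_power R I (p ^ n)); \<mm> = irrelevant_ideal R A in
      ideal_smult Q (\<mm> [^]\<^bsub>ideals_set R\<^esub> (b * p ^ n)) (zeroth_local_cohomology R \<mm> Q) = {\<zero>\<^bsub>Q\<^esub>})"
proof -
  have R: "cring R" "direct_decomposition R A"
    "\<And>i j a b. a \<in> A i \<Longrightarrow> b \<in> A j \<Longrightarrow> a \<otimes>\<^bsub>R\<^esub> b \<in> A (i + j)"
    using assms(1) unfolding standard_graded_ring_def by auto
  obtain G where G: "finite G" "G \<subseteq> A 1" "generate_ring R (A 0 \<union> G) = carrier R"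
    using assms(1) unfolding standard_graded_ring_def by auto
  interpret R: cring R by fact
  have Ac: "A n \<subseteq> carrier R" for n
    using R(2) additive_subgroup.a_subset unfolding direct_decomposition_def by blast
  then have GR: "G \<subseteq> carrier R" using G(2) by auto
  define m where "m = irrelevant_ideal R A"
  have m: "m = Idl\<^bsub>R\<^esub> G"
    unfolding m_def using R.irrelevant_ideal_eq_genideal[OF R(2,3) subfieldE(1)[OF assms(2)] G(2,3)] .
  then have m_ideal: "ideal m R" using R.genideal_ideal[OF GR] by simp
  obtain S where "S \<subseteq> (\<Union>n. A n)" "I = Idl\<^bsub>R\<^esub> S"
    using assms(7) unfolding homogeneous_ideal_def by auto
  then have I: "ideal I R" using Ac by (auto intro!: R.genideal_ideal)
  obtain s :: nat and M :: "nat \<Rightarrow> ('a, 'm) module" and D where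
    M: "\<And>i. i < s \<Longrightarrow> module R (M i)" "\<And>i. i < s \<Longrightarrow> fin_gen_module R (M i)"
    and FFRT: "\<And>n. n \<ge> 1 \<Longrightarrow> \<exists>(k :: nat \<Rightarrow> nat) (l :: nat \<Rightarrow> nat \<Rightarrow> rat).
      let J = (SIGMA i:{..<s}. {..<k i}) in
      graded_isomorphic R (frobenius_module R p n) (frobenius_grading R A p n)
        (finite_direct_sum J (\<lambda>(i, j). M i)) (direct_sum_grading J (\<lambda>(i, j). shifted (D i) (l i j)))"
    using assms(6) unfolding finite_F_representation_type_def rat_graded_module_def by blast
  let ?IM = "\<lambda>i. ideal_smult (M i) I (carrier (M i))"
  have "\<exists>b::nat. \<forall>(k::nat) v. v \<in> carrier (M i) \<longrightarrow>
      (\<forall>a \<in> m [^]\<^bsub>ideals_set R\<^esub> k. a \<odot>\<^bsub>M i\<^esub> v \<in> ?IM i) \<longrightarrow>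
      (\<forall>a \<in> m [^]\<^bsub>ideals_set R\<^esub> b. a \<odot>\<^bsub>M i\<^esub> v \<in> ?IM i)" if i: "i < s" for i
    by (rule module.torsion_stable[OF M(1)[OF i]
          acc_submodules_fin_gen_module[OF M(1)[OF i] M(2)[OF i] assms(2) G(1) GR G(3)]
          op_subgroup_ideal_smult[OF M(1)[OF i] I] m_ideal])
  \<comment> \<open>The exponents are chosen here, before \<open>n\<close> is fixed, so they depend
    only on the \<open>M i\<close>, \<open>I\<close> and \<open>m\<close>.\<close>
  then obtain b where b: "\<And>i k v a. \<lbrakk>i < s; v \<in> carrier (M i);
      \<forall>a \<in> m [^]\<^bsub>ideals_set R\<^esub> (k::nat). a \<odot>\<^bsub>M i\<^esub> v \<in> ?IM i;
      a \<in> m [^]\<^bsub>ideals_set R\<^esub> (b i :: nat)\<rbrakk> \<Longrightarrow> a \<odot>\<^bsub>M i\<^esub> v \<in> ?IM i"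
    by metis
  \<comment> \<open>Any common upper bound of the \<open>b i\<close> would do; the sum also covers
    \<open>s = 0\<close>, where there is no maximum.\<close>
  define c where "c = sum b {..<s}"
  have bc: "m [^]\<^bsub>ideals_set R\<^esub> c \<subseteq> m [^]\<^bsub>ideals_set R\<^esub> b i" if "i < s" for i
    using that by (intro R.ideal_pow_antimono[OF m_ideal]) (auto simp: c_def intro!: member_le_sum)
  have "ideal_smult (quotient_module R (frobenius_power R I (p ^ n)))
      (m [^]\<^bsub>ideals_set R\<^esub> ((c + card G) * p ^ n))
      (zeroth_local_cohomology R m (quotient_module R (frobenius_power R I (p ^ n)))) =
      {\<zero>\<^bsub>quotient_module R (frobenius_power R I (p ^ n))\<^esub>}" if n: "n \<ge> 1" for n
  proof -
    have q: "1 \<le> p ^ n" using assms(3) by (simp add: prime_gt_0_nat Suc_leI)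
    obtain k :: "nat \<Rightarrow> nat" and l :: "nat \<Rightarrow> nat \<Rightarrow> rat" where "let J = (SIGMA i:{..<s}. {..<k i}) in
      graded_isomorphic R (frobenius_module R p n) (frobenius_grading R A p n)
        (finite_direct_sum J (\<lambda>(i, j). M i)) (direct_sum_grading J (\<lambda>(i, j). shifted (D i) (l i j)))"
      using FFRT[OF n] by (elim exE) (rule that)
    then have iso: "graded_isomorphic R (frobenius_module R p n) (frobenius_grading R A p n)
        (finite_direct_sum (SIGMA i:{..<s}. {..<k i}) (\<lambda>(i, j). M i))
        (direct_sum_grading (SIGMA i:{..<s}. {..<k i}) (\<lambda>(i, j). shifted (D i) (l i j)))"
      by (simp add: Let_def)
    obtain h where "frobenius_decomposition R (p ^ n) (SIGMA i:{..<s}. {..<k i}) (\<lambda>(i, j). M i) h"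
      by (rule frobenius_decomposition_of_graded_isomorphic[OF R(1) _ _ iso]) (use M in auto)
    then interpret F: frobenius_decomposition R "p ^ n" "SIGMA i:{..<s}. {..<k i}" "\<lambda>(i, j). M i" h .
    have P: "ideal (frobenius_power R I (p ^ n)) R" by (rule R.ideal_frobenius_power[OF I])
    show ?thesis
    proof (rule R.ideal_smult_quotient_eq_zero[OF P R.ideal_pow_ideal[OF m_ideal] m_ideal])
      fix t :: nat and r a
      assume r: "r \<in> carrier R"
        and tors: "\<And>d. d \<in> m [^]\<^bsub>ideals_set R\<^esub> t \<Longrightarrow> d \<otimes>\<^bsub>R\<^esub> r \<in> frobenius_power R I (p ^ n)"
        and a: "a \<in> m [^]\<^bsub>ideals_set R\<^esub> ((c + card G) * p ^ n)"
      \<comment> \<open>The colon ideal of the Frobenius power by \<open>r\<close>. It contains the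
        \<open>q\<close>-th powers of all elements of m^c, so the exponent count puts the whole
        power of \<open>m\<close> into it.\<close>
      let ?C = "{d \<in> carrier R. r \<otimes>\<^bsub>R\<^esub> d \<in> frobenius_power R I (p ^ n)}"
      have "u [^]\<^bsub>R\<^esub> (p ^ n) \<in> ?C" if u: "u \<in> m [^]\<^bsub>ideals_set R\<^esub> c" for u
      proof -
        have uc: "u \<in> carrier R" using ideal.Icarr[OF R.ideal_pow_ideal[OF m_ideal] u] .
        have "u [^]\<^bsub>R\<^esub> (p ^ n) \<otimes>\<^bsub>R\<^esub> r \<in> frobenius_power R I (p ^ n)"
        proof (rule F.frobenius_power_colon[OF I m_ideal q _ r tors u])
          fix x v
          assume x: "x \<in> (SIGMA i:{..<s}. {..<k i})" and v: "v \<in> carrier (case x of (i, j) \<Rightarrow> M i)"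
            and t: "\<forall>a \<in> m [^]\<^bsub>ideals_set R\<^esub> t. a \<odot>\<^bsub>case x of (i, j) \<Rightarrow> M i\<^esub> v \<in>
              ideal_smult (case x of (i, j) \<Rightarrow> M i) I (carrier (case x of (i, j) \<Rightarrow> M i))"
          obtain i j where ij: "x = (i, j)" "i < s" using x by auto
          show "\<forall>a \<in> m [^]\<^bsub>ideals_set R\<^esub> c. a \<odot>\<^bsub>case x of (i, j) \<Rightarrow> M i\<^esub> v \<in>
              ideal_smult (case x of (i, j) \<Rightarrow> M i) I (carrier (case x of (i, j) \<Rightarrow> M i))"
            using b[OF ij(2), of v t] v t bc[OF ij(2)] unfolding ij(1) by auto
        qed
        then show ?thesis using uc r by (simp add: R.m_comm)
      qed
      then have "m [^]\<^bsub>ideals_set R\<^esub> ((c + card G) * p ^ n) \<subseteq> ?C"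
        using R.ideal_pow_subset_of_frobenius[OF G(1) GR R.ideal_colon[OF P r] q, of c] m by simp
      then show "a \<otimes>\<^bsub>R\<^esub> r \<in> frobenius_power R I (p ^ n)" using a r R.m_comm by auto
    qed
  qed
  then show ?thesis unfolding Let_def m_def by blast
qed

end
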